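(* Let $V>0$ and $c\in\mathbb{R}$. Let $(x_2,\varepsilon)\mapsto F(x_2,\varepsilon)$ be a Lipschitz function which is differentiable in $\varepsilon$ and satisfies $F(0,\varepsilon)\equiv F(x_2,0)\equiv 0$. Consider the discontinuous system $$\dot x_1=x_2,\qquad \dot x_2=-x_1-\varepsilon c\,x_2-\operatorname{sign}(x_2-V)\bigl(1+F(x_2-V,\varepsilon)\bigr).$$ If $$cV\pi<\int_0^{2\pi}F'_\varepsilon(V\cos\tau-V,0)\cos\tau\,d\tau,$$ where $F'_\varepsilon$ denotes the partial derivative of $F$ with respect to $\varepsilon$, then, for all $\varepsilon>0$ sufficiently small, the Filippov solution $x$ of the system with the initial condition $x(0)=(1-\varepsilon cV,\,V)^T$ reaches (at some positive time) a point $(\xi_1,V)^T$, where $\xi_1\in(-1-\varepsilon cV,\;1-\varepsilon cV)$. As a consequence, the solution $x$ is a finite-time stable limit cycle of the system.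
   Context: The system models a dry friction oscillator on a belt moving with velocity $V>0$; $\varepsilon$ is a small parameter, $c$ is a viscous friction constant, and $F$ is defined for $x_2\in\mathbb{R}$ and $\varepsilon\ge 0$ (the derivative in $\varepsilon$ at $\varepsilon=0$ being one-sided). Filippov solution: for a planar system $\dot x=f(x)$ whose right-hand side is discontinuous only along the line $x_2=V$, put $f(x_1,V^-)=\lim_{x_2\to V-0}f(x_1,x_2)$ and $f(x_1,V^+)=\lim_{x_2\to V+0}f(x_1,x_2)$. A Filippov solution is an absolutely continuous function $x(t)$ with $\dot x(t)\in K[f](x(t))$ for almost every $t$, where $K[f](x)=\{f(x)\}$ if $x_2\neq V$ and $K[f](x_1,V)=\bigcup_{\lambda\in[0,1]}\{\lambda f(x_1,V^-)+(1-\lambda)f(x_1,V^+)\}$. A point $(x_1,V)$ is a point of sliding if the second component of $f(x_1,V^-)$ is positive and the second component of $f(x_1,V^+)$ is negative; for the system considered this is the segment $x_1\in(-1-\varepsilon cV,1-\varepsilon cV)$, on which the sliding motion is $\dot x_1=V$, $\dot x_2=0$. A limit cycle is an isolated closed orbit (the trajectory of a non-constant periodic Filippov solution). It is finite-time stable if every solution starting sufficiently close to the cycle reaches the cycle in finite time and then stays on it. *)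

theory Defs
  imports "HOL-Analysis.Analysis"
begin

text \<open>
  A finite family of nonoverlapping closed subintervals of \<open>{a..b}\<close> is encoded as a division
  of its own union; \<open>Inf K\<close> and \<open>Sup K\<close> are the endpoints of the interval \<open>K\<close>.
\<close>

definition absolutely_continuous_interval ::
  "real \<Rightarrow> real \<Rightarrow> (real \<Rightarrow> 'a::real_normed_vector) \<Rightarrow> bool" where
  "absolutely_continuous_interval a b x \<longleftrightarrow>
     (\<forall>e>0. \<exists>d>0. \<forall>D. D division_of (\<Union>D) \<and> \<Union>D \<subseteq> {a..b} \<and> (\<Sum>K\<in>D. Sup K - Inf K) < d
        \<longrightarrow> (\<Sum>K\<in>D. norm (x (Sup K) - x (Inf K))) < e)"

text \<open>
  The next definitions concern \<open>x' = f x\<close> in the plane, where \<open>f\<close> may be discontinuous only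
  along the line \<open>{(x\<^sub>1, x\<^sub>2). x\<^sub>2 = V}\<close>. The value of \<open>f\<close> on that line is irrelevant.
\<close>

definition limit_below :: "(real \<times> real \<Rightarrow> real \<times> real) \<Rightarrow> real \<Rightarrow> real \<Rightarrow> real \<times> real" where
  "limit_below f V x1 = Lim (at_left V) (\<lambda>x2. f (x1, x2))"

definition limit_above :: "(real \<times> real \<Rightarrow> real \<times> real) \<Rightarrow> real \<Rightarrow> real \<Rightarrow> real \<times> real" where
  "limit_above f V x1 = Lim (at_right V) (\<lambda>x2. f (x1, x2))"

definition filippov_set ::
  "(real \<times> real \<Rightarrow> real \<times> real) \<Rightarrow> real \<Rightarrow> real \<times> real \<Rightarrow> (real \<times> real) set" where
  "filippov_set f V x =
     (if snd x \<noteq> V then {f x}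
      else \<Union>l\<in>{0..1}. {l *\<^sub>R limit_below f V (fst x) + (1 - l) *\<^sub>R limit_above f V (fst x)})"

definition filippov_solution ::
  "(real \<times> real \<Rightarrow> real \<times> real) \<Rightarrow> real \<Rightarrow> (real \<Rightarrow> real \<times> real) \<Rightarrow> bool" where
  "filippov_solution f V x \<longleftrightarrow>
     (\<forall>b\<ge>0. absolutely_continuous_interval 0 b x) \<and>
     (AE t in lebesgue. t \<ge> 0 \<longrightarrow>
        (\<exists>v\<in>filippov_set f V (x t). (x has_vector_derivative v) (at t within {0..})))"

definition trajectory :: "(real \<Rightarrow> real \<times> real) \<Rightarrow> (real \<times> real) set" where
  "trajectory x = x ` {0..}"

definition nonconstant_periodic_solution ::
  "(real \<times> real \<Rightarrow> real \<times> real) \<Rightarrow> real \<Rightarrow> (real \<Rightarrow> real \<times> real) \<Rightarrow> bool" where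
  "nonconstant_periodic_solution f V x \<longleftrightarrow>
     filippov_solution f V x \<and>
     (\<exists>T>0. \<forall>t\<ge>0. x (t + T) = x t) \<and>
     (\<exists>t\<ge>0. x t \<noteq> x 0)"

definition limit_cycle ::
  "(real \<times> real \<Rightarrow> real \<times> real) \<Rightarrow> real \<Rightarrow> (real \<Rightarrow> real \<times> real) \<Rightarrow> bool" where
  "limit_cycle f V x \<longleftrightarrow>
     nonconstant_periodic_solution f V x \<and>
     (\<exists>U. open U \<and> trajectory x \<subseteq> U \<and>
        (\<forall>y. nonconstant_periodic_solution f V y \<and> trajectory y \<inter> U \<noteq> {}
             \<longrightarrow> trajectory y = trajectory x))"

definition finite_time_stable ::
  "(real \<times> real \<Rightarrow> real \<times> real) \<Rightarrow> real \<Rightarrow> (real \<times> real) set \<Rightarrow> bool" where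
  "finite_time_stable f V C \<longleftrightarrow>
     (\<exists>d>0. \<forall>y. filippov_solution f V y \<and> infdist (y 0) C < d
        \<longrightarrow> (\<exists>T\<ge>0. \<forall>t\<ge>T. y t \<in> C))"

definition friction_field ::
  "real \<Rightarrow> real \<Rightarrow> (real \<Rightarrow> real \<Rightarrow> real) \<Rightarrow> real \<Rightarrow> real \<times> real \<Rightarrow> real \<times> real" where
  "friction_field V c F \<epsilon> = (\<lambda>(x1, x2).
     (x2, - x1 - \<epsilon> * c * x2 - sgn (x2 - V) * (1 + F (x2 - V) \<epsilon>)))"

end

theory Submission
  imports Defs
begin

text \<open>
  Below the switching line the system is a harmonic oscillator centred at \<open>(1, 0)\<close> with a small
  perturbation. For \<open>\<epsilon> = 0\<close> the orbit from \<open>(1, V)\<close> is the circle of radius \<open>V\<close>, which only grazes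
  the line \<open>x\<^sub>2 = V\<close>. The criterion says that during one turn the energy
  \<open>(x\<^sub>1 - 1)\<^sup>2 + x\<^sub>2\<^sup>2\<close> grows by at least \<open>\<epsilon> m\<close> for some \<open>m > 0\<close> (lemma \<open>energy_gain\<close>). Hence, close to
  time \<open>2 \<pi>\<close>, the orbit comes back to the line at a distance of order \<open>sqrt \<epsilon>\<close> to the left of \<open>x\<^sub>1 = 1\<close>.
  The end \<open>1 - \<epsilon> c V\<close> of the sliding segment is only at a distance of order \<open>\<epsilon>\<close> from \<open>1\<close>, so the
  orbit lands inside the segment (lemma \<open>return_to_line\<close>), slides to its right end, which is the
  initial point, and starts again.

  The function \<open>F u \<epsilon> / \<epsilon>\<close> converges to \<open>DF u 0\<close> for each \<open>u\<close> only, and its Lipschitz constant in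
  \<open>u\<close> may blow up like \<open>1 / \<epsilon>\<close>. Therefore the perturbed orbit cannot be replaced by the circle in the
  argument of \<open>F\<close> by a pointwise estimate, although the two differ by \<open>O(\<epsilon>)\<close>. Lemma
  \<open>integral_compose_stable\<close> makes this replacement under the integral: for curves that are close
  together with their derivatives, integrals of \<open>H\<close> along them differ by little, uniformly over all
  continuous \<open>H\<close> with a given bound. The limit \<open>\<epsilon> \<longlongrightarrow> 0\<close> is then taken on the circle, by dominated
  convergence.

  The statements on solutions rest on one estimate. Dry friction is a monotone term, so that the
  Filippov set is one-sided Lipschitz; hence any two Filippov solutions separate at most
  exponentially (lemma \<open>solutions_distance_growth\<close>). This gives uniqueness forward in time. It also
  gives finite-time stability: a solution that starts near the cycle is still near it when the cycle
  slides, is pushed there onto the sliding segment from either side, and coincides with the cycle from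
  that moment on by uniqueness (lemma \<open>merges_with_orbit\<close>). A periodic solution that meets a
  neighbourhood of the cycle has to merge with it in this way, so the cycle is isolated.
\<close>

section \<open>Absolutely continuous functions\<close>

lemma absolutely_continuous_intervalE:
  assumes "absolutely_continuous_interval a b x" "e > 0"
  obtains d where "d > 0" "\<And>D. D division_of (\<Union>D) \<Longrightarrow> \<Union>D \<subseteq> {a..b} \<Longrightarrow>
      (\<Sum>K\<in>D. Sup K - Inf K) < d \<Longrightarrow> (\<Sum>K\<in>D. norm (x (Sup K) - x (Inf K))) < e"
  using assms(1)[unfolded absolutely_continuous_interval_def, rule_format, OF assms(2)] that by blast

lemma absolutely_continuous_interval_subset:
  assumes "absolutely_continuous_interval a b x" "{a'..b'} \<subseteq> {a..b}"
  shows "absolutely_continuous_interval a' b' x"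
  using assms unfolding absolutely_continuous_interval_def by (meson order.trans)

lemma division_real_interval:
  fixes D :: "real set set"
  assumes "D division_of (\<Union>D)" "\<Union>D \<subseteq> {a..b}" "K \<in> D"
  shows "Inf K \<le> Sup K" "Inf K \<in> {a..b}" "Sup K \<in> {a..b}" "K = {Inf K..Sup K}"
proof -
  obtain u v where K: "K = cbox u v" and "K \<noteq> {}"
    using division_ofD(3,4)[OF assms(1,3)] by blast
  then have uv: "u \<le> v" "K = {u..v}" by auto
  moreover have "K \<subseteq> {a..b}" using assms by blast
  ultimately show "Inf K \<le> Sup K" "Inf K \<in> {a..b}" "Sup K \<in> {a..b}" "K = {Inf K..Sup K}"
    by auto
qed

text \<open>
  The closure properties below follow from this comparison: the increments of \<open>g\<close> are dominated
  by those of two absolutely continuous functions.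
\<close>

lemma absolutely_continuous_interval_dominated:
  assumes x: "absolutely_continuous_interval a b x" and y: "absolutely_continuous_interval a b y"
    and g: "\<And>s t. s \<in> {a..b} \<Longrightarrow> t \<in> {a..b} \<Longrightarrow>
      norm (g t - g s) \<le> B * (norm (x t - x s) + norm (y t - y s))"
  shows "absolutely_continuous_interval a b g"
  unfolding absolutely_continuous_interval_def
proof (intro allI impI)
  fix e :: real assume "e > 0"
  define e' where "e' = e / (2 * (\<bar>B\<bar> + 1))"
  have "e' > 0" using \<open>e > 0\<close> by (simp add: e'_def)
  obtain d1 where d1: "d1 > 0" and x1: "\<And>D. D division_of (\<Union>D) \<Longrightarrow> \<Union>D \<subseteq> {a..b} \<Longrightarrow>
      (\<Sum>K\<in>D. Sup K - Inf K) < d1 \<Longrightarrow> (\<Sum>K\<in>D. norm (x (Sup K) - x (Inf K))) < e'"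
    using absolutely_continuous_intervalE[OF x \<open>e' > 0\<close>] by blast
  obtain d2 where d2: "d2 > 0" and y2: "\<And>D. D division_of (\<Union>D) \<Longrightarrow> \<Union>D \<subseteq> {a..b} \<Longrightarrow>
      (\<Sum>K\<in>D. Sup K - Inf K) < d2 \<Longrightarrow> (\<Sum>K\<in>D. norm (y (Sup K) - y (Inf K))) < e'"
    using absolutely_continuous_intervalE[OF y \<open>e' > 0\<close>] by blast
  show "\<exists>d>0. \<forall>D. D division_of (\<Union>D) \<and> \<Union>D \<subseteq> {a..b} \<and> (\<Sum>K\<in>D. Sup K - Inf K) < d
        \<longrightarrow> (\<Sum>K\<in>D. norm (g (Sup K) - g (Inf K))) < e"
  proof (intro exI[of _ "min d1 d2"] conjI allI impI; (elim conjE)?)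
    fix D assume D: "D division_of (\<Union>D)" "\<Union>D \<subseteq> {a..b}" "(\<Sum>K\<in>D. Sup K - Inf K) < min d1 d2"
    have "(\<Sum>K\<in>D. norm (g (Sup K) - g (Inf K)))
        \<le> (\<Sum>K\<in>D. (\<bar>B\<bar> + 1) * (norm (x (Sup K) - x (Inf K)) + norm (y (Sup K) - y (Inf K))))"
    proof (rule sum_mono)
      fix K assume "K \<in> D"
      note K = division_real_interval[OF D(1,2) this]
      have "norm (g (Sup K) - g (Inf K))
          \<le> B * (norm (x (Sup K) - x (Inf K)) + norm (y (Sup K) - y (Inf K)))"
        using K by (intro g)
      also have "\<dots> \<le> (\<bar>B\<bar> + 1) * (norm (x (Sup K) - x (Inf K)) + norm (y (Sup K) - y (Inf K)))"
        by (intro mult_right_mono) auto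
      finally show "norm (g (Sup K) - g (Inf K)) \<le> \<dots>" .
    qed
    also have "\<dots> = (\<bar>B\<bar> + 1) * ((\<Sum>K\<in>D. norm (x (Sup K) - x (Inf K))) + (\<Sum>K\<in>D. norm (y (Sup K) - y (Inf K))))"
      unfolding sum_distrib_left[symmetric] sum.distrib ..
    also have "\<dots> < (\<bar>B\<bar> + 1) * (e' + e')"
      using x1[OF D(1,2)] y2[OF D(1,2)] D(3) by (intro mult_strict_left_mono add_strict_mono) auto
    also have "\<dots> = (2 * (\<bar>B\<bar> + 1)) * e'" by simp
    also have "\<dots> = e" unfolding e'_def by simp
    finally show "(\<Sum>K\<in>D. norm (g (Sup K) - g (Inf K))) < e" .
  qed (use d1 d2 in auto)
qed

lemma absolutely_continuous_interval_id: "absolutely_continuous_interval a b (\<lambda>t::real. t)"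
  unfolding absolutely_continuous_interval_def
proof (intro allI impI)
  fix e :: real assume "e > 0"
  show "\<exists>d>0. \<forall>D. D division_of (\<Union>D) \<and> \<Union>D \<subseteq> {a..b} \<and> (\<Sum>K\<in>D. Sup K - Inf K) < d
        \<longrightarrow> (\<Sum>K\<in>D. norm (Sup K - Inf K)) < e"
  proof (intro exI[of _ e] conjI allI impI; (elim conjE)?)
    fix D assume D: "D division_of (\<Union>D)" "\<Union>D \<subseteq> {a..b}" "(\<Sum>K\<in>D. Sup K - Inf K) < e"
    have "(\<Sum>K\<in>D. norm (Sup K - Inf K)) = (\<Sum>K\<in>D. Sup K - Inf K)"
      using division_real_interval(1)[OF D(1,2)] by (intro sum.cong) auto
    with D show "(\<Sum>K\<in>D. norm (Sup K - Inf K)) < e" by simp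
  qed (fact \<open>e > 0\<close>)
qed

lemma lipschitz_imp_absolutely_continuous_interval:
  fixes x :: "real \<Rightarrow> 'a::real_normed_vector"
  assumes "B-lipschitz_on {a..b} x"
  shows "absolutely_continuous_interval a b x"
proof (rule absolutely_continuous_interval_dominated[OF absolutely_continuous_interval_id absolutely_continuous_interval_id])
  show "norm (x t - x s) \<le> B * (norm (t - s) + norm (t - s))" if "s \<in> {a..b}" "t \<in> {a..b}" for s t
  proof -
    have "norm (x t - x s) \<le> B * norm (t - s)"
      using lipschitz_onD[OF assms that(2,1)] by (simp add: dist_norm)
    also have "\<dots> \<le> B * (norm (t - s) + norm (t - s))"
      using lipschitz_on_nonneg[OF assms] by (intro mult_left_mono) auto
    finally show ?thesis .
  qed
qed

lemma absolutely_continuous_interval_imp_continuous_on: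
  assumes "absolutely_continuous_interval a b x"
  shows "continuous_on {a..b} x"
  unfolding continuous_on_iff
proof (intro ballI allI impI)
  fix s e :: real assume s: "s \<in> {a..b}" and "e > 0"
  obtain d where d: "d > 0" and x: "\<And>D. D division_of (\<Union>D) \<Longrightarrow> \<Union>D \<subseteq> {a..b} \<Longrightarrow>
      (\<Sum>K\<in>D. Sup K - Inf K) < d \<Longrightarrow> (\<Sum>K\<in>D. norm (x (Sup K) - x (Inf K))) < e"
    using absolutely_continuous_intervalE[OF assms \<open>e > 0\<close>] by blast
  show "\<exists>d>0. \<forall>t\<in>{a..b}. dist t s < d \<longrightarrow> dist (x t) (x s) < e"
  proof (intro exI[of _ d] conjI ballI impI d)
    fix t assume t: "t \<in> {a..b}" "dist t s < d"
    define u v where "u = min s t" and "v = max s t"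
    have uv: "u \<le> v" "{u..v} \<subseteq> {a..b}" "v - u < d"
      using s t by (auto simp: u_def v_def dist_real_def)
    have "{{u..v}} division_of (\<Union>{{u..v}})"
      using division_of_self[of u v] uv(1) by simp
    from x[OF this] have "norm (x v - x u) < e"
      using uv by simp
    then show "dist (x t) (x s) < e"
      by (auto simp: u_def v_def dist_norm norm_minus_commute min_def max_def split: if_splits)
  qed
qed

lemma absolutely_continuous_interval_bounded:
  assumes "absolutely_continuous_interval a b x"
  obtains B where "B \<ge> 0" "\<And>t. t \<in> {a..b} \<Longrightarrow> norm (x t) \<le> B"
proof -
  have "compact (x ` {a..b})"
    using absolutely_continuous_interval_imp_continuous_on[OF assms] by (intro compact_continuous_image) auto
  then obtain B where "\<And>y. y \<in> x ` {a..b} \<Longrightarrow> norm y \<le> B"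
    using compact_imp_bounded bounded_iff by metis
  then have "0 \<le> max B 0" "\<And>t. t \<in> {a..b} \<Longrightarrow> norm (x t) \<le> max B 0" by fastforce+
  then show thesis using that by blast
qed

lemma absolutely_continuous_interval_bilinear:
  assumes "bounded_bilinear h"
    and x: "absolutely_continuous_interval a b x" and y: "absolutely_continuous_interval a b y"
  shows "absolutely_continuous_interval a b (\<lambda>t. h (x t) (y t))"
proof -
  interpret bounded_bilinear h by fact
  obtain C where C: "C \<ge> 0" "\<And>u v. norm (h u v) \<le> norm u * norm v * C"
    using nonneg_bounded by blast
  obtain X where X: "X \<ge> 0" "\<And>t. t \<in> {a..b} \<Longrightarrow> norm (x t) \<le> X"
    using absolutely_continuous_interval_bounded[OF x] by blast
  obtain Y where Y: "Y \<ge> 0" "\<And>t. t \<in> {a..b} \<Longrightarrow> norm (y t) \<le> Y"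
    using absolutely_continuous_interval_bounded[OF y] by blast
  show ?thesis
  proof (rule absolutely_continuous_interval_dominated[OF x y])
    fix s t assume st: "s \<in> {a..b}" "t \<in> {a..b}"
    have "h (x t) (y t) - h (x s) (y s) = h (x t - x s) (y t) + h (x s) (y t - y s)"
      by (simp add: diff_left diff_right)
    also have "norm \<dots> \<le> norm (x t - x s) * norm (y t) * C + norm (x s) * norm (y t - y s) * C"
      by (intro norm_triangle_le add_mono C)
    also have "\<dots> \<le> norm (x t - x s) * (X + Y) * C + (X + Y) * norm (y t - y s) * C"
      using C X(1) Y(1) X(2)[OF st(1)] Y(2)[OF st(2)] by (intro add_mono mult_right_mono mult_left_mono) auto
    also have "\<dots> = ((X + Y) * C) * (norm (x t - x s) + norm (y t - y s))"
      by (simp add: algebra_simps)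
    finally show "norm (h (x t) (y t) - h (x s) (y s))
        \<le> ((X + Y) * C) * (norm (x t - x s) + norm (y t - y s))" .
  qed
qed

lemma absolutely_continuous_interval_diff:
  assumes x: "absolutely_continuous_interval a b x" and y: "absolutely_continuous_interval a b y"
  shows "absolutely_continuous_interval a b (\<lambda>t. x t - y t)"
proof (rule absolutely_continuous_interval_dominated[OF x y])
  fix s t
  have "norm (x t - y t - (x s - y s)) = norm ((x t - x s) - (y t - y s))" by (simp add: algebra_simps)
  also have "\<dots> \<le> 1 * (norm (x t - x s) + norm (y t - y s))"
    using norm_triangle_ineq4 by simp
  finally show "norm (x t - y t - (x s - y s)) \<le> \<dots>" .
qed

lemma absolutely_continuous_interval_linear:
  assumes "bounded_linear h" and x: "absolutely_continuous_interval a b x"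
  shows "absolutely_continuous_interval a b (\<lambda>t. h (x t))"
proof -
  interpret bounded_linear h by fact
  obtain C where C: "C \<ge> 0" "\<And>u. norm (h u) \<le> norm u * C"
    using nonneg_bounded by blast
  show ?thesis
  proof (rule absolutely_continuous_interval_dominated[OF x x])
    fix s t
    have "norm (h (x t) - h (x s)) \<le> norm (x t - x s) * C"
      using C(2)[of "x t - x s"] by (simp add: diff)
    also have "\<dots> \<le> C * (norm (x t - x s) + norm (x t - x s))"
      using C(1) by (simp add: algebra_simps)
    finally show "norm (h (x t) - h (x s)) \<le> \<dots>" .
  qed
qed

lemma absolutely_continuous_interval_translate:
  assumes "absolutely_continuous_interval (a + s) (b + s) x"
  shows "absolutely_continuous_interval a b (\<lambda>t. x (t + s))"
  unfolding absolutely_continuous_interval_def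
proof (intro allI impI)
  fix e :: real assume "e > 0"
  obtain d where d: "d > 0" and x: "\<And>D. D division_of (\<Union>D) \<Longrightarrow> \<Union>D \<subseteq> {a+s..b+s} \<Longrightarrow>
      (\<Sum>K\<in>D. Sup K - Inf K) < d \<Longrightarrow> (\<Sum>K\<in>D. norm (x (Sup K) - x (Inf K))) < e"
    using absolutely_continuous_intervalE[OF assms \<open>e > 0\<close>] by blast
  show "\<exists>d>0. \<forall>D. D division_of (\<Union>D) \<and> \<Union>D \<subseteq> {a..b} \<and> (\<Sum>K\<in>D. Sup K - Inf K) < d
        \<longrightarrow> (\<Sum>K\<in>D. norm (x (Sup K + s) - x (Inf K + s))) < e"
  proof (intro exI[of _ d] conjI allI impI d; elim conjE)
    fix D assume D: "D division_of (\<Union>D)" "\<Union>D \<subseteq> {a..b}" "(\<Sum>K\<in>D. Sup K - Inf K) < d"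
    note I = division_real_interval[OF D(1,2)]
    define E where "E = (\<lambda>K. (+) s ` K) ` D"
    have img: "(+) s ` K = {Inf K + s..Sup K + s}" if "K \<in> D" for K
      using I(4)[OF that] by (metis add.commute[of s] image_add_atLeastAtMost)
    have bounds: "Sup ((+) s ` K) = Sup K + s" "Inf ((+) s ` K) = Inf K + s" if "K \<in> D" for K
      using I(1)[OF that] img[OF that] by auto
    have inj: "inj_on (\<lambda>K. (+) s ` K) D"
      by (intro inj_onI) (auto simp: inj_image_eq_iff)
    have UE: "\<Union>E = (+) s ` \<Union>D" by (auto simp: E_def)
    have "E division_of \<Union>E"
    proof (rule division_ofI)
      show "finite E" using D(1) by (auto simp: E_def)
      show "L \<subseteq> \<Union>E" if "L \<in> E" for L using that by blast
      show "L \<noteq> {}" if "L \<in> E" for L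
        using that division_ofD(3)[OF D(1)] by (auto simp: E_def)
      show "\<exists>u v. L = cbox u v" if "L \<in> E" for L
        using that img by (auto simp: E_def)
      show "interior L \<inter> interior L' = {}" if L: "L \<in> E" "L' \<in> E" "L \<noteq> L'" for L L'
      proof -
        obtain K where K: "L = (+) s ` K" "K \<in> D" using L(1) unfolding E_def by blast
        obtain K' where K': "L' = (+) s ` K'" "K' \<in> D" using L(2) unfolding E_def by blast
        have "interior K \<inter> interior K' = {}"
          using division_ofD(5)[OF D(1) K(2) K'(2)] K K' L(3) by blast
        then show ?thesis
          unfolding K(1) K'(1) interior_translation by auto
      qed
    qed simp
    moreover have "\<Union>E \<subseteq> {a+s..b+s}"
      unfolding UE using D(2) by auto
    moreover have "(\<Sum>K\<in>E. Sup K - Inf K) = (\<Sum>K\<in>D. Sup K - Inf K)"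
      unfolding E_def sum.reindex[OF inj] by (intro sum.cong) (auto simp: bounds)
    moreover have "(\<Sum>K\<in>E. norm (x (Sup K) - x (Inf K))) = (\<Sum>K\<in>D. norm (x (Sup K + s) - x (Inf K + s)))"
      unfolding E_def sum.reindex[OF inj] by (intro sum.cong) (auto simp: bounds)
    ultimately show "(\<Sum>K\<in>D. norm (x (Sup K + s) - x (Inf K + s))) < e"
      using x[of E] D(3) by simp
  qed
qed

lemma tagged_parts_total_length_le:
  fixes U :: "real set"
  assumes p: "p tagged_partial_division_of {a..b}"
    and U: "U \<in> lmeasurable" "\<And>t K. (t, K) \<in> p \<Longrightarrow> K \<subseteq> U"
  shows "(\<Sum>K\<in>snd ` p. Sup K - Inf K) \<le> measure lebesgue U"
proof -
  note div = partial_division_of_tagged_division[OF p]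
  have sub: "\<Union>(snd ` p) \<subseteq> {a..b}" using tagged_partial_division_ofD(3)[OF p] by fastforce
  have "(\<Sum>K\<in>snd ` p. Sup K - Inf K) = sum (measure lborel) (snd ` p)"
  proof (intro sum.cong refl)
    fix K assume "K \<in> snd ` p"
    note K = division_real_interval[OF div sub this]
    show "Sup K - Inf K = measure lborel K"
      using K(1) by (subst (3) K(4)) simp
  qed
  also have "\<dots> = sum (measure lebesgue) (snd ` p)"
    by (intro sum.cong refl) (metis division_ofD(4)[OF div] measure_completion lborelD borel_closed closed_cbox)
  also have "\<dots> = measure lebesgue (\<Union>(snd ` p))"
    using content_division[OF div] by simp
  also have "\<dots> \<le> measure lebesgue U"
  proof (rule measure_mono_fmeasurable)
    show "\<Union>(snd ` p) \<in> sets lebesgue"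
      using lmeasurable_division[OF div] by blast
    show "\<Union>(snd ` p) \<subseteq> U" using U(2) by force
  qed (fact U(1))
  finally show ?thesis .
qed

text \<open>
  A gauge argument. Tags outside the null set \<open>N\<close> see the sign of the derivative; the intervals
  whose tag lies in \<open>N\<close> are forced into an open set of small measure, so that absolute continuity
  makes their total contribution negligible.
\<close>

lemma absolutely_continuous_interval_decreasing:
  fixes f :: "real \<Rightarrow> real"
  assumes "a \<le> b" and f: "absolutely_continuous_interval a b f" and N: "negligible N"
    and deriv: "\<And>t. t \<in> {a..b} - N \<Longrightarrow> \<exists>d\<le>0. (f has_real_derivative d) (at t within {a..b})"
  shows "f b \<le> f a"
proof (rule field_le_epsilon)
  fix e :: real assume "e > 0"
  define r where "r = e / (2 * (b - a + 1))"
  have r: "r > 0" "r * (b - a) \<le> e / 2"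
    using \<open>e > 0\<close> \<open>a \<le> b\<close> by (auto simp: r_def field_simps)
  obtain d where d: "d > 0" and fd: "\<And>D. D division_of (\<Union>D) \<Longrightarrow> \<Union>D \<subseteq> {a..b} \<Longrightarrow>
      (\<Sum>K\<in>D. Sup K - Inf K) < d \<Longrightarrow> (\<Sum>K\<in>D. norm (f (Sup K) - f (Inf K))) < e / 2"
    using absolutely_continuous_intervalE[OF f half_gt_zero[OF \<open>e > 0\<close>]] by blast
  have N0: "N \<in> null_sets lebesgue" using N by (simp add: negligible_iff_null_sets)
  then obtain U where U: "open U" "N \<subseteq> U" "U - N \<in> lmeasurable" "emeasure lebesgue (U - N) < ennreal d"
    using sets_lebesgue_outer_open[of N d] \<open>d > 0\<close> by blast
  have Un: "U = (U - N) \<union> N" using U by auto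
  have Um: "U \<in> lmeasurable"
    using fmeasurable.Un[OF U(3) fmeasurableI_null_sets[OF N0]] Un by simp
  have "emeasure lebesgue U < ennreal d"
    using U(3,4) N0 by (subst Un, subst emeasure_Un_null_set) auto
  then have Ud: "measure lebesgue U < d"
    using Um d by (metis emeasure_eq_measure2 ennreal_less_iff measure_nonneg)
  have "\<exists>s>0. \<forall>y\<in>{a..b}. \<bar>y - t\<bar> < s \<longrightarrow> (t \<le> y \<longrightarrow> f y - f t \<le> r * (y - t)) \<and> (y \<le> t \<longrightarrow> f t - f y \<le> r * (t - y))"
    if t: "t \<in> {a..b} - N" for t
  proof -
    obtain D where D: "D \<le> 0" "(f has_real_derivative D) (at t within {a..b})"
      using deriv[OF t] by blast
    obtain s where s: "s > 0" "\<And>y. y \<in> {a..b} \<Longrightarrow> norm (y - t) < s \<Longrightarrow>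
        norm (f y - f t - D * (y - t)) \<le> r * norm (y - t)"
      using D(2) r(1) unfolding has_field_derivative_def has_derivative_within_alt by blast
    show ?thesis
    proof (intro exI[of _ s] conjI ballI impI s)
      fix y assume y: "y \<in> {a..b}" "\<bar>y - t\<bar> < s"
      have *: "\<bar>f y - f t - D * (y - t)\<bar> \<le> r * \<bar>y - t\<bar>" using s(2)[of y] y by simp
      show "f y - f t \<le> r * (y - t)" if "t \<le> y"
        using * that mult_nonpos_nonneg[OF D(1), of "y - t"] by (simp add: abs_le_iff)
      show "f t - f y \<le> r * (t - y)" if "y \<le> t"
        using * that mult_nonpos_nonneg[OF D(1), of "t - y"] by (simp add: abs_le_iff algebra_simps)
    qed
  qed
  then obtain s where s: "\<And>t. t \<in> {a..b} - N \<Longrightarrow> s t > 0"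
      "\<And>t y. t \<in> {a..b} - N \<Longrightarrow> y \<in> {a..b} \<Longrightarrow> \<bar>y - t\<bar> < s t \<Longrightarrow>
        (t \<le> y \<longrightarrow> f y - f t \<le> r * (y - t)) \<and> (y \<le> t \<longrightarrow> f t - f y \<le> r * (t - y))"
    by metis
  \<comment> \<open>A tag in the null set may only carry an interval that lies in \<open>U\<close>.\<close>
  define g where "g t = (if t \<in> N then U else if t \<in> {a..b} then ball t (s t) else UNIV)" for t
  have "gauge g"
    using U s(1) unfolding gauge_def g_def by auto
  then obtain p where p: "p tagged_division_of {a..b}" and fine: "g fine p"
    using fine_division_exists_real by blast
  have pD: "Inf K \<le> t \<and> t \<le> Sup K \<and> a \<le> Inf K \<and> Sup K \<le> b \<and> K = {Inf K..Sup K}" if "(t, K) \<in> p" for t K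
  proof -
    have "t \<in> K" "K \<subseteq> {a..b}" using tagged_division_ofD(2,3)[OF p] that by blast+
    moreover obtain u v where "K = cbox u v" using tagged_division_ofD(4)[OF p] \<open>(t, K) \<in> p\<close> by blast
    ultimately show ?thesis by auto
  qed
  define P where "P = {q \<in> p. fst q \<in> N}"
  have finp: "finite p" using p by blast
  have P: "P tagged_partial_division_of {a..b}"
    using p unfolding tagged_division_of_def P_def by (auto intro: tagged_partial_division_subset)
  have "f b - f a = (\<Sum>(t,K)\<in>p. f (Sup K) - f (Inf K))"
    using additive_tagged_division_1[OF \<open>a \<le> b\<close> p] by metis
  also have "\<dots> = (\<Sum>(t,K)\<in>P. f (Sup K) - f (Inf K)) + (\<Sum>(t,K)\<in>p-P. f (Sup K) - f (Inf K))"
    using sum.subset_diff[of P p] finp by (simp add: P_def add.commute)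
  also have "(\<Sum>(t,K)\<in>P. f (Sup K) - f (Inf K)) = (\<Sum>(t,K)\<in>P. if K = {} then 0 else f (Sup K) - f (Inf K))"
    using tagged_partial_division_ofD(2)[OF P] by (intro sum.cong refl) fastforce
  also have "\<dots> = (\<Sum>K\<in>snd ` P. if K = {} then 0 else f (Sup K) - f (Inf K))"
  proof (rule sum.over_tagged_division_lemma[OF tagged_partial_division_of_Union_self[OF P]])
    show "(if cbox u v = {} then 0 else f (Sup (cbox u v)) - f (Inf (cbox u v))) = 0"
      if "box u v = {}" for u v :: real
      using that by (cases "u = v") auto
  qed
  also have "\<dots> \<le> (\<Sum>K\<in>snd ` P. norm (f (Sup K) - f (Inf K)))"
    by (intro sum_mono) auto
  also have "\<dots> < e / 2"
  proof (rule fd)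
    show "snd ` P division_of \<Union>(snd ` P)" by (rule partial_division_of_tagged_division[OF P])
    show "\<Union>(snd ` P) \<subseteq> {a..b}" using tagged_partial_division_ofD(3)[OF P] by fastforce
    have "K \<subseteq> U" if "(t, K) \<in> P" for t K
      using that fine unfolding fine_def P_def g_def by force
    then have "(\<Sum>K\<in>snd ` P. Sup K - Inf K) \<le> measure lebesgue U"
      by (intro tagged_parts_total_length_le[OF P Um])
    then show "(\<Sum>K\<in>snd ` P. Sup K - Inf K) < d" using Ud by simp
  qed
  also have "(\<Sum>(t,K)\<in>p-P. f (Sup K) - f (Inf K)) \<le> (\<Sum>(t,K)\<in>p-P. r * (Sup K - Inf K))"
  proof (intro sum_mono; clarify)
    fix t K assume tK: "(t, K) \<in> p" "(t, K) \<notin> P"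
    then have t: "t \<notin> N" by (simp add: P_def)
    note K = pD[OF tK(1)]
    have ab: "t \<in> {a..b} - N" "Inf K \<in> {a..b}" "Sup K \<in> {a..b}" using K t by auto
    have "K \<subseteq> ball t (s t)"
      using fine tK ab unfolding fine_def g_def by fastforce
    moreover have "Inf K \<in> K" "Sup K \<in> K" using K by (metis atLeastAtMost_iff order.refl order.trans)+
    ultimately have "\<bar>Inf K - t\<bar> < s t" "\<bar>Sup K - t\<bar> < s t"
      by (auto simp: dist_real_def abs_minus_commute subset_iff)
    then have "f (Sup K) - f t \<le> r * (Sup K - t)" "f t - f (Inf K) \<le> r * (t - Inf K)"
      using s(2)[OF ab(1,2)] s(2)[OF ab(1,3)] K by auto
    then show "f (Sup K) - f (Inf K) \<le> r * (Sup K - Inf K)"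
      by (simp add: algebra_simps)
  qed
  also have "\<dots> \<le> (\<Sum>(t,K)\<in>p. r * (Sup K - Inf K))"
    using r pD finp by (intro sum_mono2) fastforce+
  also have "\<dots> = r * (b - a)"
    using additive_tagged_division_1[OF \<open>a \<le> b\<close> p, of "\<lambda>x. x"]
    by (simp add: split_def flip: sum_distrib_left)
  also have "\<dots> \<le> e / 2" by (rule r)
  finally show "f b \<le> f a + e" by simp
qed

section \<open>Filippov solutions of the friction oscillator\<close>

lemma AE_lebesgue_negligibleE:
  assumes "AE t in lebesgue. P t"
  obtains N where "negligible N" "\<And>t. t \<notin> N \<Longrightarrow> P t"
proof -
  obtain N where "N \<in> null_sets lebesgue" "{t \<in> space lebesgue. \<not> P t} \<subseteq> N"
    using assms unfolding eventually_ae_filter by blast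
  then show thesis
    using that[of N] by (auto simp: negligible_iff_null_sets)
qed

lemma AE_lebesgueI_negligible:
  assumes "negligible N" "\<And>t. t \<notin> N \<Longrightarrow> P t"
  shows "AE t in lebesgue. P t"
  using assms unfolding eventually_ae_filter negligible_iff_null_sets
  by (intro bexI[of _ N]) auto

lemma filippov_solution_derivativeE:
  assumes "filippov_solution f V x"
  obtains N where "negligible N" "\<And>t. t \<ge> 0 \<Longrightarrow> t \<notin> N \<Longrightarrow>
    \<exists>v\<in>filippov_set f V (x t). (x has_vector_derivative v) (at t within {0..})"
  using assms AE_lebesgue_negligibleE unfolding filippov_solution_def by (smt (verit))

lemma filippov_solution_continuous_on:
  assumes "filippov_solution f V x" "a \<ge> 0"
  shows "continuous_on {a..b} x"
proof (cases "a \<le> b")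
  case True
  then have "continuous_on {0..b} x"
    using assms True unfolding filippov_solution_def
    by (intro absolutely_continuous_interval_imp_continuous_on) auto
  then show ?thesis using assms(2) by (auto intro: continuous_on_subset)
qed simp

lemma filippov_solution_shift:
  assumes x: "filippov_solution f V x" and "s \<ge> 0"
  shows "filippov_solution f V (\<lambda>t. x (t + s))"
  unfolding filippov_solution_def
proof (intro conjI allI impI)
  fix b :: real assume "b \<ge> 0"
  then have "absolutely_continuous_interval 0 (b + s) x"
    using x \<open>s \<ge> 0\<close> unfolding filippov_solution_def by auto
  then have "absolutely_continuous_interval (0 + s) (b + s) x"
    using \<open>s \<ge> 0\<close> by (elim absolutely_continuous_interval_subset) auto
  then show "absolutely_continuous_interval 0 b (\<lambda>t. x (t + s))"
    by (rule absolutely_continuous_interval_translate)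
next
  obtain N where N: "negligible N" "\<And>t. t \<ge> 0 \<Longrightarrow> t \<notin> N \<Longrightarrow>
      \<exists>v\<in>filippov_set f V (x t). (x has_vector_derivative v) (at t within {0..})"
    using filippov_solution_derivativeE[OF x] by blast
  show "AE t in lebesgue. 0 \<le> t \<longrightarrow> (\<exists>v\<in>filippov_set f V (x (t + s)).
      ((\<lambda>t. x (t + s)) has_vector_derivative v) (at t within {0..}))"
  proof (rule AE_lebesgueI_negligible[OF negligible_translation[OF N(1), of "-s"]]; rule impI)
    fix t assume t: "t \<notin> (+) (- s) ` N" "0 \<le> t"
    have "t + s \<notin> N"
      using t(1) by (metis add.commute add_minus_cancel image_eqI)
    then obtain v where v: "v \<in> filippov_set f V (x (t + s))"
        "(x has_vector_derivative v) (at (t + s) within {0..})"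
      using N(2)[of "t + s"] t \<open>s \<ge> 0\<close> by auto
    have "(x \<circ> (\<lambda>t. t + s) has_vector_derivative 1 *\<^sub>R v) (at t within {0..})"
    proof (rule vector_diff_chain_within)
      show "((\<lambda>t. t + s) has_vector_derivative 1) (at t within {0..})"
        by (auto intro!: derivative_eq_intros)
      show "(x has_vector_derivative v) (at (t + s) within (\<lambda>t. t + s) ` {0..})"
        using v(2) by (rule has_vector_derivative_within_subset) (use \<open>s \<ge> 0\<close> in auto)
    qed
    then show "\<exists>v\<in>filippov_set f V (x (t + s)). ((\<lambda>t. x (t + s)) has_vector_derivative v) (at t within {0..})"
      using v(1) by (auto simp: o_def)
  qed
qed

locale friction_oscillator =
  fixes V c \<epsilon> L :: real and F :: "real \<Rightarrow> real \<Rightarrow> real"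
  assumes V_pos: "V > 0"
    and F_zero: "F 0 \<epsilon> = 0"
    and F_lipschitz: "\<And>u v. \<bar>F u \<epsilon> - F v \<epsilon>\<bar> \<le> L * \<bar>u - v\<bar>"
begin

abbreviation "solution \<equiv> filippov_solution (friction_field V c F \<epsilon>) V"

text \<open>
  The one-sided Lipschitz constant of the Filippov set.
\<close>

definition "M = \<bar>\<epsilon> * c\<bar> + L"

text \<open>
  The field that governs the slip phase, extended to the whole plane.
\<close>

definition "lower x = (snd x, - fst x - \<epsilon> * c * snd x + 1 + F (snd x - V) \<epsilon>)"

lemma L_nonneg: "L \<ge> 0"
  using order_trans[OF abs_ge_zero F_lipschitz[of 1 0]] by simp

lemma M_nonneg: "M \<ge> 0"
  using L_nonneg by (simp add: M_def)

lemma F_bound: "\<bar>F u \<epsilon>\<bar> \<le> L * \<bar>u\<bar>"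
  using F_lipschitz[of u 0] F_zero by simp

lemma F_continuous: "continuous_on S (\<lambda>u. F u \<epsilon>)"
proof -
  have "L-lipschitz_on S (\<lambda>u. F u \<epsilon>)"
    using F_lipschitz L_nonneg by (intro lipschitz_onI) (auto simp: dist_real_def)
  then show ?thesis by (rule lipschitz_on_continuous_on)
qed

text \<open>
  The part of the friction force that remains after splitting off the pure sign. Since \<open>F\<close> vanishes
  at velocity zero, it is Lipschitz across the switching line.
\<close>

definition "kappa u = sgn u * F u \<epsilon>"

lemma kappa_lipschitz: "\<bar>kappa u - kappa v\<bar> \<le> L * \<bar>u - v\<bar>"
proof -
  consider "u > 0" "v > 0" | "u < 0" "v < 0" | "u \<ge> 0" "v \<le> 0" | "u \<le> 0" "v \<ge> 0" by linarith
  then show ?thesis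
  proof cases
    case 3
    have "\<bar>kappa u - kappa v\<bar> \<le> \<bar>F u \<epsilon>\<bar> + \<bar>F v \<epsilon>\<bar>"
      using 3 by (auto simp: kappa_def sgn_if)
    also have "\<dots> \<le> L * \<bar>u\<bar> + L * \<bar>v\<bar>" by (intro add_mono F_bound)
    also have "\<dots> = L * \<bar>u - v\<bar>" using 3 by (simp add: algebra_simps)
    finally show ?thesis .
  next
    case 4
    have "\<bar>kappa u - kappa v\<bar> \<le> \<bar>F u \<epsilon>\<bar> + \<bar>F v \<epsilon>\<bar>"
      using 4 by (auto simp: kappa_def sgn_if)
    also have "\<dots> \<le> L * \<bar>u\<bar> + L * \<bar>v\<bar>" by (intro add_mono F_bound)
    also have "\<dots> = L * \<bar>u - v\<bar>" using 4 by (simp add: algebra_simps)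
    finally show ?thesis .
  qed (use F_lipschitz[of u v] in \<open>auto simp: kappa_def abs_minus_commute\<close>)
qed

lemma kappa_bound: "\<bar>kappa u\<bar> \<le> L * \<bar>u\<bar>"
  using kappa_lipschitz[of u 0] by (simp add: kappa_def)

lemma friction_field_eq:
  "friction_field V c F \<epsilon> (x1, x2) = (x2, - x1 - \<epsilon> * c * x2 - sgn (x2 - V) - kappa (x2 - V))"
  by (simp add: friction_field_def kappa_def algebra_simps)

lemma kappa_tendsto: "((\<lambda>x2. kappa (x2 - V)) \<longlongrightarrow> 0) (at V within S)"
proof (rule Lim_null_comparison)
  show "\<forall>\<^sub>F x in at V within S. norm (kappa (x - V)) \<le> L * \<bar>x - V\<bar>"
    using kappa_bound by (intro always_eventually) auto
  have "((\<lambda>x. L * \<bar>x - V\<bar>) \<longlongrightarrow> L * \<bar>V - V\<bar>) (at V within S)"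
    by (intro tendsto_intros)
  then show "((\<lambda>x. L * \<bar>x - V\<bar>) \<longlongrightarrow> 0) (at V within S)" by simp
qed

lemma limit_below_friction_field:
  "limit_below (friction_field V c F \<epsilon>) V x1 = (V, - x1 - \<epsilon> * c * V + 1)"
  unfolding limit_below_def
proof (rule tendsto_Lim)
  have "((\<lambda>x2. (x2, - x1 - \<epsilon> * c * x2 + 1 - kappa (x2 - V))) \<longlongrightarrow> (V, - x1 - \<epsilon> * c * V + 1 - 0)) (at_left V)"
    by (intro tendsto_intros kappa_tendsto)
  moreover have "\<forall>\<^sub>F x2 in at_left V. (x2, - x1 - \<epsilon> * c * x2 + 1 - kappa (x2 - V)) = friction_field V c F \<epsilon> (x1, x2)"
    unfolding friction_field_eq by (auto simp: eventually_at_filter)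
  ultimately show "((\<lambda>x2. friction_field V c F \<epsilon> (x1, x2)) \<longlongrightarrow> (V, - x1 - \<epsilon> * c * V + 1)) (at_left V)"
    by (simp add: tendsto_cong)
qed simp

lemma limit_above_friction_field:
  "limit_above (friction_field V c F \<epsilon>) V x1 = (V, - x1 - \<epsilon> * c * V - 1)"
  unfolding limit_above_def
proof (rule tendsto_Lim)
  have "((\<lambda>x2. (x2, - x1 - \<epsilon> * c * x2 - 1 - kappa (x2 - V))) \<longlongrightarrow> (V, - x1 - \<epsilon> * c * V - 1 - 0)) (at_right V)"
    by (intro tendsto_intros kappa_tendsto)
  moreover have "\<forall>\<^sub>F x2 in at_right V. (x2, - x1 - \<epsilon> * c * x2 - 1 - kappa (x2 - V)) = friction_field V c F \<epsilon> (x1, x2)"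
    unfolding friction_field_eq by (auto simp: eventually_at_filter)
  ultimately show "((\<lambda>x2. friction_field V c F \<epsilon> (x1, x2)) \<longlongrightarrow> (V, - x1 - \<epsilon> * c * V - 1)) (at_right V)"
    by (simp add: tendsto_cong)
qed simp

text \<open>
  The Filippov regularization replaces \<open>sgn\<close> by the maximal monotone sign relation, whose value at zero
  is the whole interval \<open>{-1..1}\<close>. All other terms are Lipschitz.
\<close>

lemma filippov_set_iff:
  "v \<in> filippov_set (friction_field V c F \<epsilon>) V a \<longleftrightarrow>
    (\<exists>s\<in>{-1..1}. (snd a \<noteq> V \<longrightarrow> s = sgn (snd a - V)) \<and>
       v = (snd a, - fst a - \<epsilon> * c * snd a - s - kappa (snd a - V)))"
proof (cases "snd a = V")
  case False
  have "sgn (snd a - V) \<in> {-1..1}" by (simp add: sgn_if)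
  with False show ?thesis
    using friction_field_eq[of "fst a" "snd a"] by (auto simp: filippov_set_def)
next
  case True
  have mix: "l *\<^sub>R (V, - fst a - \<epsilon> * c * V + 1) + (1 - l) *\<^sub>R (V, - fst a - \<epsilon> * c * V - 1)
      = (V, - fst a - \<epsilon> * c * V - (1 - 2 * l))" for l
    by (simp add: algebra_simps)
  have "v \<in> filippov_set (friction_field V c F \<epsilon>) V a \<longleftrightarrow>
      (\<exists>l\<in>{0..1}. v = (V, - fst a - \<epsilon> * c * V - (1 - 2 * l)))"
    using True by (simp add: filippov_set_def limit_below_friction_field limit_above_friction_field mix
        del: scaleR_Pair add_Pair)
  also have "\<dots> \<longleftrightarrow> (\<exists>s\<in>{-1..1}. v = (V, - fst a - \<epsilon> * c * V - s))"
  proof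
    assume "\<exists>l\<in>{0..1}. v = (V, - fst a - \<epsilon> * c * V - (1 - 2 * l))"
    then obtain l where "l \<in> {0..1}" "v = (V, - fst a - \<epsilon> * c * V - (1 - 2 * l))" by blast
    then show "\<exists>s\<in>{-1..1}. v = (V, - fst a - \<epsilon> * c * V - s)"
      by (intro bexI[of _ "1 - 2 * l"]) auto
  next
    assume "\<exists>s\<in>{-1..1}. v = (V, - fst a - \<epsilon> * c * V - s)"
    then obtain s where s: "s \<in> {-1..1}" "v = (V, - fst a - \<epsilon> * c * V - s)" by blast
    define l where "l = (1 - s) / 2"
    have "s = 1 - 2 * l" unfolding l_def by (simp add: field_simps)
    moreover have "l \<in> {0..1}" using s(1) by (auto simp: l_def)
    ultimately show "\<exists>l\<in>{0..1}. v = (V, - fst a - \<epsilon> * c * V - (1 - 2 * l))" using s(2) by blast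
  qed
  finally show ?thesis using True by (simp add: kappa_def)
qed

text \<open>
  The discontinuous term contributes \<open>- (s - r) * (snd a - snd b)\<close>, which has the good sign because the
  sign relation is monotone.
\<close>

lemma filippov_set_one_sided_lipschitz:
  assumes v: "v \<in> filippov_set (friction_field V c F \<epsilon>) V a"
    and w: "w \<in> filippov_set (friction_field V c F \<epsilon>) V b"
  shows "inner (v - w) (a - b) \<le> M * (norm (a - b))\<^sup>2"
proof -
  obtain a1 a2 b1 b2 where [simp]: "a = (a1, a2)" "b = (b1, b2)" by fastforce
  obtain s where s: "s \<in> {-1..1}" "a2 \<noteq> V \<longrightarrow> s = sgn (a2 - V)"
      "v = (a2, - a1 - \<epsilon> * c * a2 - s - kappa (a2 - V))"
    using v unfolding filippov_set_iff by auto
  obtain r where r: "r \<in> {-1..1}" "b2 \<noteq> V \<longrightarrow> r = sgn (b2 - V)"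
      "w = (b2, - b1 - \<epsilon> * c * b2 - r - kappa (b2 - V))"
    using w unfolding filippov_set_iff by auto
  define d where "d = a2 - b2"
  have mono: "(s - r) * d \<ge> 0"
    using s(1,2) r(1,2) by (cases "a2 = V"; cases "b2 = V")
      (auto simp: d_def sgn_if zero_le_mult_iff split: if_splits)
  have "- (\<epsilon> * c * d * d) - (kappa (a2 - V) - kappa (b2 - V)) * d \<le> \<bar>\<epsilon> * c\<bar> * d\<^sup>2 + L * d\<^sup>2"
  proof -
    have "- (\<epsilon> * c * d * d) = (- (\<epsilon> * c)) * d\<^sup>2" by (simp add: power2_eq_square)
    also have "\<dots> \<le> \<bar>\<epsilon> * c\<bar> * d\<^sup>2" by (intro mult_right_mono) auto
    finally have 1: "- (\<epsilon> * c * d * d) \<le> \<bar>\<epsilon> * c\<bar> * d\<^sup>2" .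
    have "- ((kappa (a2 - V) - kappa (b2 - V)) * d) \<le> \<bar>kappa (a2 - V) - kappa (b2 - V)\<bar> * \<bar>d\<bar>"
      by (metis abs_ge_minus_self abs_mult)
    also have "\<dots> \<le> (L * \<bar>d\<bar>) * \<bar>d\<bar>"
      using kappa_lipschitz[of "a2 - V" "b2 - V"] by (intro mult_right_mono) (auto simp: d_def)
    also have "\<dots> = L * d\<^sup>2" by (simp add: power2_eq_square mult.assoc)
    finally show ?thesis using 1 by simp
  qed
  moreover have "inner (v - w) (a - b) =
      - (s - r) * d - \<epsilon> * c * d * d - (kappa (a2 - V) - kappa (b2 - V)) * d"
    by (simp add: s(3) r(3) d_def algebra_simps)
  ultimately have "inner (v - w) (a - b) \<le> M * d\<^sup>2"
    using mono by (simp add: M_def algebra_simps)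
  also have "\<dots> \<le> M * (norm (a - b))\<^sup>2"
    using M_nonneg by (intro mult_left_mono) (auto simp: norm_Pair d_def)
  finally show ?thesis .
qed

text \<open>
  Gronwall's argument for the squared distance. It is absolutely continuous, and its derivative is
  controlled almost everywhere by the one-sided Lipschitz bound.
\<close>

lemma solutions_distance_growth:
  assumes x: "solution x" and y: "solution y" and "t \<ge> 0"
  shows "norm (x t - y t) \<le> exp (M * t) * norm (x 0 - y 0)"
proof -
  define g where "g s = exp (- (2 * M) * s) * inner (x s - y s) (x s - y s)" for s
  have AC: "absolutely_continuous_interval 0 t x" "absolutely_continuous_interval 0 t y"
    using x y \<open>t \<ge> 0\<close> unfolding filippov_solution_def by auto
  have "(2 * M)-lipschitz_on {0..t} (\<lambda>s. exp (- (2 * M) * s))"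
  proof (rule bounded_derivative_imp_lipschitz)
    show "((\<lambda>s. exp (- (2 * M) * s)) has_derivative (\<lambda>h. (exp (- (2 * M) * s) * (- (2 * M))) * h)) (at s within {0..t})" for s
      by (rule has_field_derivative_imp_has_derivative) (auto intro!: derivative_eq_intros)
    show "onorm (\<lambda>h. (exp (- (2 * M) * s) * (- (2 * M))) * h) \<le> 2 * M" if "s \<in> {0..t}" for s
    proof -
      have "exp (- (2 * M) * s) \<le> 1" using that M_nonneg by (simp add: zero_le_mult_iff)
      then show ?thesis
        using M_nonneg by (intro onorm_le) (auto simp: abs_mult intro!: mult_right_mono mult_left_le_one_le)
    qed
  qed (use M_nonneg in auto)
  then have "absolutely_continuous_interval 0 t g"
    unfolding g_def
    by (intro absolutely_continuous_interval_bilinear[OF bounded_bilinear_mult]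
        absolutely_continuous_interval_bilinear[OF bounded_bilinear_inner]
        absolutely_continuous_interval_diff AC lipschitz_imp_absolutely_continuous_interval)
  moreover obtain N1 where N1: "negligible N1" "\<And>t. t \<ge> 0 \<Longrightarrow> t \<notin> N1 \<Longrightarrow>
      \<exists>v\<in>filippov_set (friction_field V c F \<epsilon>) V (x t). (x has_vector_derivative v) (at t within {0..})"
    using filippov_solution_derivativeE[OF x] by blast
  moreover obtain N2 where N2: "negligible N2" "\<And>t. t \<ge> 0 \<Longrightarrow> t \<notin> N2 \<Longrightarrow>
      \<exists>v\<in>filippov_set (friction_field V c F \<epsilon>) V (y t). (y has_vector_derivative v) (at t within {0..})"
    using filippov_solution_derivativeE[OF y] by blast
  moreover have "\<exists>d\<le>0. (g has_real_derivative d) (at s within {0..t})" if s: "s \<in> {0..t} - (N1 \<union> N2)" for s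
  proof -
    obtain v where v: "v\<in>filippov_set (friction_field V c F \<epsilon>) V (x s)" "(x has_vector_derivative v) (at s within {0..})"
      using N1(2)[of s] s by auto
    obtain w where w: "w\<in>filippov_set (friction_field V c F \<epsilon>) V (y s)" "(y has_vector_derivative w) (at s within {0..})"
      using N2(2)[of s] s by auto
    define D where "D = exp (- (2 * M) * s) * (2 * inner (v - w) (x s - y s))
        + exp (- (2 * M) * s) * (- (2 * M)) * inner (x s - y s) (x s - y s)"
    have "((\<lambda>s. x s - y s) has_vector_derivative (v - w)) (at s within {0..t})"
      by (intro has_vector_derivative_diff has_vector_derivative_within_subset[OF v(2)]
          has_vector_derivative_within_subset[OF w(2)]) auto
    from bounded_bilinear.has_vector_derivative[OF bounded_bilinear_inner this this]
    have "((\<lambda>s. inner (x s - y s) (x s - y s)) has_real_derivative 2 * inner (v - w) (x s - y s)) (at s within {0..t})"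
      by (simp add: has_real_derivative_iff_has_vector_derivative inner_commute)
    then have "(g has_real_derivative D) (at s within {0..t})"
      unfolding g_def D_def by (auto intro!: derivative_eq_intros)
    moreover have "D \<le> 0"
    proof -
      have "D = 2 * exp (- (2 * M) * s) * (inner (v - w) (x s - y s) - M * (norm (x s - y s))\<^sup>2)"
        by (simp add: D_def power2_norm_eq_inner algebra_simps)
      then show ?thesis
        using filippov_set_one_sided_lipschitz[OF v(1) w(1)] by (simp add: mult_le_0_iff)
    qed
    ultimately show ?thesis by blast
  qed
  ultimately have "g t \<le> g 0"
    using \<open>t \<ge> 0\<close> by (intro absolutely_continuous_interval_decreasing[of 0 t g "N1 \<union> N2"]) auto
  then have "exp (- (2 * M) * t) * (norm (x t - y t))\<^sup>2 \<le> (norm (x 0 - y 0))\<^sup>2"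
    by (simp add: g_def power2_norm_eq_inner)
  then have "exp (2 * (M * t)) * (exp (- (2 * M) * t) * (norm (x t - y t))\<^sup>2) \<le> exp (2 * (M * t)) * (norm (x 0 - y 0))\<^sup>2"
    by (intro mult_left_mono) auto
  moreover have "exp (2 * (M * t)) * (exp (- (2 * M) * t) * (norm (x t - y t))\<^sup>2) = (norm (x t - y t))\<^sup>2"
    by (simp add: mult.assoc[symmetric] exp_minus_inverse)
  moreover have "exp (2 * (M * t)) * (norm (x 0 - y 0))\<^sup>2 = (exp (M * t) * norm (x 0 - y 0))\<^sup>2"
    by (simp add: power_mult_distrib exp_double)
  ultimately have "(norm (x t - y t))\<^sup>2 \<le> (exp (M * t) * norm (x 0 - y 0))\<^sup>2"
    by linarith
  then show ?thesis by (rule power2_le_imp_le) simp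
qed

lemma solution_unique:
  assumes "solution x" "solution y" "x 0 = y 0" "t \<ge> 0"
  shows "x t = y t"
  using solutions_distance_growth[OF assms(1,2,4)] assms(3) by simp

text \<open>
  On the line itself the field from below is one end of the Filippov segment, so an arc of the lower
  equation is a Filippov solution as long as it does not rise above the line; it may touch it.
\<close>

lemma lower_in_filippov_set:
  assumes "snd a \<le> V"
  shows "lower a \<in> filippov_set (friction_field V c F \<epsilon>) V a"
  unfolding filippov_set_iff
  by (rule bexI[of _ "-1"]) (use assms F_zero in \<open>auto simp: lower_def kappa_def sgn_if\<close>)

lemma sliding_in_filippov_set:
  assumes "x1 \<in> {- 1 - \<epsilon> * c * V..1 - \<epsilon> * c * V}"
  shows "(V, 0) \<in> filippov_set (friction_field V c F \<epsilon>) V (x1, V)"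
  unfolding filippov_set_iff
  by (rule bexI[of _ "- x1 - \<epsilon> * c * V"]) (use assms in \<open>auto simp: kappa_def\<close>)

lemma continuous_on_lower: "continuous_on S lower"
  unfolding lower_def
  by (intro continuous_intros continuous_on_compose2[OF F_continuous[of UNIV]]) auto

text \<open>
  Friction dominates near the sliding segment: as long as the line is not reached, the distance to it
  decreases at a rate of at least \<open>\<eta>\<close>.
\<close>

lemma reaches_switching_line:
  assumes y: "solution y" and ab: "0 \<le> a" "a \<le> b"
    and near: "\<And>t. t \<in> {a..b} \<Longrightarrow> \<bar>fst (y t) + \<epsilon> * c * V\<bar> + M * \<bar>snd (y t) - V\<bar> \<le> 1 - \<eta>"
    and start: "\<bar>snd (y a) - V\<bar> < \<eta> * (b - a)"
  shows "\<exists>t\<in>{a..b}. snd (y t) = V"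
proof (rule ccontr)
  assume no: "\<not> ?thesis"
  have cont: "continuous_on {a..b} (\<lambda>t. snd (y t))"
    using filippov_solution_continuous_on[OF y ab(1)] by (intro continuous_intros)
  \<comment> \<open>The sign \<open>\<sigma>\<close> of the side on which \<open>y\<close> starts treats both sides at once.\<close>
  define \<sigma> :: real where "\<sigma> = sgn (V - snd (y a))"
  have "snd (y a) \<noteq> V" using no ab by force
  then have \<sigma>: "\<sigma> = 1 \<or> \<sigma> = -1" by (auto simp: \<sigma>_def sgn_if)
  have side: "sgn (V - snd (y t)) = \<sigma>" if t: "t \<in> {a..b}" for t
  proof (rule ccontr)
    assume "sgn (V - snd (y t)) \<noteq> \<sigma>"
    then have "(snd (y a) \<le> V \<and> V \<le> snd (y t)) \<or> (snd (y t) \<le> V \<and> V \<le> snd (y a))"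
      by (auto simp: \<sigma>_def sgn_if split: if_splits)
    moreover have "continuous_on {a..t} (\<lambda>t. snd (y t))"
      using cont by (rule continuous_on_subset) (use t in auto)
    ultimately obtain s where "a \<le> s" "s \<le> t" "snd (y s) = V"
      using IVT'[of "\<lambda>t. snd (y t)" a V t] IVT2'[of "\<lambda>t. snd (y t)" t V a] t by auto
    then show False using no t by auto
  qed
  have abs: "\<bar>snd (y t) - V\<bar> = \<sigma> * (V - snd (y t))" if "t \<in> {a..b}" for t
    using side[OF that] by (auto simp: sgn_if split: if_splits)
  define g where "g t = (\<eta> * t + \<sigma> * V) - \<sigma> * snd (y t)" for t
  obtain N where N: "negligible N" "\<And>t. t \<ge> 0 \<Longrightarrow> t \<notin> N \<Longrightarrow>
      \<exists>v\<in>filippov_set (friction_field V c F \<epsilon>) V (y t). (y has_vector_derivative v) (at t within {0..})"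
    using filippov_solution_derivativeE[OF y] by blast
  have "g b \<le> g a"
  proof (rule absolutely_continuous_interval_decreasing[OF ab(2) _ N(1)])
    have "absolutely_continuous_interval 0 b y"
      using y ab unfolding filippov_solution_def by auto
    then have "absolutely_continuous_interval a b y"
      by (rule absolutely_continuous_interval_subset) (use ab in auto)
    then have "absolutely_continuous_interval a b (\<lambda>t. \<sigma> * snd (y t))"
      by (rule absolutely_continuous_interval_linear[rotated])
        (intro bounded_linear_intros)
    moreover have "absolutely_continuous_interval a b (\<lambda>t. \<eta> * t + \<sigma> * V)"
      by (intro lipschitz_imp_absolutely_continuous_interval[of "\<bar>\<eta>\<bar>"] lipschitz_onI)
        (auto simp: dist_real_def abs_mult simp flip: right_diff_distrib)
    ultimately show "absolutely_continuous_interval a b g"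
      unfolding g_def by (intro absolutely_continuous_interval_diff)
  next
    fix t assume t: "t \<in> {a..b} - N"
    then obtain v where v: "v \<in> filippov_set (friction_field V c F \<epsilon>) V (y t)"
        "(y has_vector_derivative v) (at t within {0..})"
      using N(2)[of t] ab by auto
    have "snd (y t) \<noteq> V" using no t by blast
    then have sg: "sgn (snd (y t) - V) = - \<sigma>"
      using side[of t] t by (auto simp: sgn_if split: if_splits)
    have v2: "snd v = - fst (y t) - \<epsilon> * c * snd (y t) + \<sigma> - kappa (snd (y t) - V)"
      using v(1) sg \<open>snd (y t) \<noteq> V\<close> unfolding filippov_set_iff by auto
    have "((\<lambda>t. snd (y t)) has_vector_derivative snd v) (at t within {a..b})"
      by (rule bounded_linear.has_vector_derivative[OF bounded_linear_snd],
          rule has_vector_derivative_within_subset[OF v(2)]) (use ab in auto)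
    then have "(g has_real_derivative \<eta> - \<sigma> * snd v) (at t within {a..b})"
      unfolding g_def has_real_derivative_iff_has_vector_derivative[symmetric]
      by (auto intro!: derivative_eq_intros)
    moreover have "\<sigma> * snd v \<ge> \<eta>"
    proof -
      let ?u = "snd (y t) - V"
      have "\<sigma> * snd v = 1 - \<sigma> * (fst (y t) + \<epsilon> * c * V) - \<sigma> * (\<epsilon> * c * ?u) - \<sigma> * kappa ?u"
        using \<sigma> by (auto simp: v2 algebra_simps)
      moreover have "\<sigma> * (fst (y t) + \<epsilon> * c * V) \<le> \<bar>fst (y t) + \<epsilon> * c * V\<bar>"
        using \<sigma> by auto
      moreover have "\<sigma> * (\<epsilon> * c * ?u) \<le> \<bar>\<epsilon> * c\<bar> * \<bar>?u\<bar>"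
        using \<sigma> by (auto simp flip: abs_mult)
      moreover have "\<sigma> * kappa ?u \<le> L * \<bar>?u\<bar>"
        using \<sigma> kappa_bound[of ?u] by auto
      ultimately show ?thesis
        using near[of t] t by (simp add: M_def algebra_simps)
    qed
    ultimately show "\<exists>d\<le>0. (g has_real_derivative d) (at t within {a..b})"
      by (intro exI[of _ "\<eta> - \<sigma> * snd v"]) auto
  qed
  then have "\<eta> * (b - a) + \<sigma> * (V - snd (y b)) \<le> \<sigma> * (V - snd (y a))"
    by (simp add: g_def algebra_simps)
  then have "\<eta> * (b - a) + \<bar>snd (y b) - V\<bar> \<le> \<bar>snd (y a) - V\<bar>"
    using abs[of a] abs[of b] ab by simp
  then show False using start by linarith
qed

end

section \<open>The stick-slip orbit\<close>

text \<open>
  The slip arc \<open>\<phi>\<close> leaves the right end of the sliding segment and lands inside the segment at time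
  \<open>\<tau>\<close>. The assumption \<open>slip_below\<close> allows the arc to touch the line on its way.
\<close>

locale stick_slip_orbit = friction_oscillator +
  fixes \<phi> :: "real \<Rightarrow> real \<times> real" and \<tau> \<xi> :: real
  assumes tau_pos: "\<tau> > 0"
    and slip: "\<And>t. t \<in> {0..\<tau>} \<Longrightarrow> (\<phi> has_vector_derivative lower (\<phi> t)) (at t within {0..\<tau>})"
    and slip_below: "\<And>t. t \<in> {0..\<tau>} \<Longrightarrow> snd (\<phi> t) \<le> V"
    and slip_start: "\<phi> 0 = (1 - \<epsilon> * c * V, V)"
    and slip_end: "\<phi> \<tau> = (\<xi>, V)"
    and xi: "\<xi> \<in> {- 1 - \<epsilon> * c * V <..< 1 - \<epsilon> * c * V}"
begin

definition "stick_time = (1 - \<epsilon> * c * V - \<xi>) / V"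

definition "T = \<tau> + stick_time"

text \<open>
  One lap consists of the slip arc and the sliding motion back to the starting point. Composing it with
  the fractional part extends it periodically.
\<close>

definition "lap t = (if t \<le> \<tau> then \<phi> t else (\<xi> + V * (t - \<tau>), V))"

definition "orbit t = lap (T * frac (t / T))"

lemma stick_pos: "stick_time > 0"
  using xi V_pos by (simp add: stick_time_def)

lemma V_stick: "V * stick_time = 1 - \<epsilon> * c * V - \<xi>"
  using V_pos by (simp add: stick_time_def)

lemma T_gt: "T > \<tau>" "T > 0"
  using stick_pos tau_pos by (auto simp: T_def)

lemma lap_0: "lap 0 = (1 - \<epsilon> * c * V, V)"
  using tau_pos slip_start by (simp add: lap_def)

lemma lap_T: "lap T = (1 - \<epsilon> * c * V, V)"
  using T_gt V_stick by (simp add: lap_def T_def)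

lemma lap_stick: "r \<ge> 0 \<Longrightarrow> lap (\<tau> + r) = (\<xi> + V * r, V)"
  using slip_end by (cases "r = 0") (auto simp: lap_def)

lemma orbit_eq_lap: "t \<in> {0..T} \<Longrightarrow> orbit t = lap t"
proof (cases "t = T")
  case True
  then show ?thesis using T_gt(2) lap_0 lap_T by (simp add: orbit_def)
next
  case False
  assume "t \<in> {0..T}"
  with False have "t / T \<in> {0..<1}" using T_gt(2) by simp
  then have "frac (t / T) = t / T" by (rule frac_eq_id)
  then show ?thesis using T_gt(2) by (simp add: orbit_def)
qed

lemma orbit_shift: "orbit (t + T) = orbit t"
proof -
  have "(t + T) / T = t / T + 1" using T_gt(2) by (simp add: field_simps)
  then show ?thesis by (simp only: orbit_def frac_1_eq)
qed

lemma orbit_shift_nat: "orbit (real n * T + t) = orbit t"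
proof (induction n)
  case (Suc n)
  have "orbit (real (Suc n) * T + t) = orbit ((real n * T + t) + T)"
    by (simp add: algebra_simps)
  then show ?case using orbit_shift Suc by simp
qed simp

lemma lap_lipschitz: obtains B where "B-lipschitz_on {0..T} lap"
proof -
  have "continuous_on {0..\<tau>} \<phi>"
    unfolding continuous_on_eq_continuous_within
    using slip has_vector_derivative_continuous by blast
  then have "continuous_on {0..\<tau>} (\<lambda>t. lower (\<phi> t))"
    by (intro continuous_on_compose2[OF continuous_on_lower[of UNIV]]) auto
  then have "bounded ((\<lambda>t. lower (\<phi> t)) ` {0..\<tau>})"
    by (intro compact_imp_bounded compact_continuous_image) auto
  then obtain B0 where B0: "\<And>t. t \<in> {0..\<tau>} \<Longrightarrow> norm (lower (\<phi> t)) \<le> B0"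
    unfolding bounded_iff by (meson imageI)
  define B where "B = max B0 V"
  have 1: "B-lipschitz_on {0..\<tau>} \<phi>"
  proof (rule bounded_derivative_imp_lipschitz)
    show "(\<phi> has_derivative (\<lambda>h. h *\<^sub>R lower (\<phi> t))) (at t within {0..\<tau>})" if "t \<in> {0..\<tau>}" for t
      using slip[OF that] by (simp add: has_vector_derivative_def)
    show "onorm (\<lambda>h. h *\<^sub>R lower (\<phi> t)) \<le> B" if "t \<in> {0..\<tau>}" for t
      using B0[OF that] V_pos
      by (intro onorm_le) (auto simp: B_def mult.commute intro!: mult_left_mono)
  qed (use V_pos in \<open>auto simp: B_def\<close>)
  have 2: "B-lipschitz_on {\<tau>..T} (\<lambda>t. (\<xi> + V * (t - \<tau>), V))"
  proof (rule lipschitz_on_le)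
    show "V-lipschitz_on {\<tau>..T} (\<lambda>t. (\<xi> + V * (t - \<tau>), V))"
      using V_pos by (intro lipschitz_onI) (auto simp: dist_Pair_Pair dist_real_def abs_mult simp flip: right_diff_distrib)
  qed (simp add: B_def)
  have "B-lipschitz_on {0..T} lap"
    unfolding lap_def by (rule lipschitz_on_concat[OF 1 2]) (simp add: slip_end)
  then show thesis by (rule that)
qed

lemma frac_bounds: "T * frac (t / T) \<in> {0..<T}"
proof -
  have "T * frac (t / T) < T * 1"
    by (rule mult_strict_left_mono[OF frac_lt_1 T_gt(2)])
  moreover have "0 \<le> T * frac (t / T)"
    by (rule mult_nonneg_nonneg[OF less_imp_le[OF T_gt(2)] frac_ge_0])
  ultimately show ?thesis by simp
qed

lemma orbit_lipschitz: obtains B where "B-lipschitz_on UNIV orbit"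
proof -
  obtain B where B: "B-lipschitz_on {0..T} lap" by (rule lap_lipschitz)
  have "B \<ge> 0" using B by (rule lipschitz_on_nonneg)
  have bound: "dist (orbit s) (orbit t) \<le> B * (t - s)" if "s \<le> t" for s t
  proof -
    define m n where "m = \<lfloor>s / T\<rfloor>" and "n = \<lfloor>t / T\<rfloor>"
    define s' t' where "s' = T * frac (s / T)" and "t' = T * frac (t / T)"
    have s: "s' \<in> {0..T}" "s = m * T + s'" and t: "t' \<in> {0..T}" "t = n * T + t'"
      using frac_bounds[of s] frac_bounds[of t] T_gt
      by (auto simp: s'_def t'_def m_def n_def frac_def field_simps)
    have "m \<le> n"
      unfolding m_def n_def using that T_gt by (intro floor_mono divide_right_mono) auto
    show ?thesis
    proof (cases "m = n")
      case True
      then have "dist (orbit s) (orbit t) \<le> B * \<bar>s' - t'\<bar>"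
        using lipschitz_onD[OF B s(1) t(1)] by (simp add: orbit_def s'_def t'_def dist_real_def)
      also have "\<bar>s' - t'\<bar> = t - s" using that s(2) t(2) True by auto
      finally show ?thesis .
    next
      case False
      with \<open>m \<le> n\<close> have "real_of_int m + 1 \<le> real_of_int n" by linarith
      then have "(real_of_int m + 1) * T \<le> real_of_int n * T"
        using T_gt by (intro mult_right_mono) auto
      \<comment> \<open>Both branches agree at the end of a lap, so the path is split there.\<close>
      then have gap: "(T - s') + t' \<le> t - s" using s(2) t(2) by (simp add: algebra_simps)
      have "dist (orbit s) (orbit t) \<le> dist (lap s') (lap T) + dist (lap 0) (lap t')"
        using dist_triangle[of "lap s'" "lap t'" "lap T"] by (simp add: orbit_def s'_def t'_def lap_0 lap_T)
      also have "\<dots> \<le> B * \<bar>s' - T\<bar> + B * \<bar>0 - t'\<bar>"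
        using lipschitz_onD[OF B s(1), of T] lipschitz_onD[OF B _ t(1), of 0] T_gt
        by (intro add_mono) (auto simp: dist_real_def)
      also have "\<dots> = B * ((T - s') + t')"
        using s t by (simp add: algebra_simps)
      also have "\<dots> \<le> B * (t - s)"
        using gap \<open>B \<ge> 0\<close> by (intro mult_left_mono)
      finally show ?thesis .
    qed
  qed
  have "B-lipschitz_on UNIV orbit"
  proof (rule lipschitz_onI)
    show "dist (orbit s) (orbit t) \<le> B * dist s t" for s t
      using bound[of s t] bound[of t s] by (cases "s \<le> t") (auto simp: dist_real_def dist_commute)
  qed (fact \<open>B \<ge> 0\<close>)
  then show thesis by (rule that)
qed

lemma lap_derivative:
  assumes "t \<in> {0<..<T}" "t \<noteq> \<tau>"
  shows "\<exists>v\<in>filippov_set (friction_field V c F \<epsilon>) V (lap t). (lap has_vector_derivative v) (at t)"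
proof (cases "t < \<tau>")
  case True
  have "(\<phi> has_vector_derivative lower (\<phi> t)) (at t within {0..\<tau>})"
    using slip assms True by auto
  then have "(\<phi> has_vector_derivative lower (\<phi> t)) (at t)"
    using at_within_Icc_at[of 0 t \<tau>] assms True by simp
  then have "(lap has_vector_derivative lower (\<phi> t)) (at t)"
    by (rule has_vector_derivative_transform_within_open[of _ _ _ "{0<..<\<tau>}"])
      (use assms True in \<open>auto simp: lap_def\<close>)
  moreover have "lap t = \<phi> t" using True by (simp add: lap_def)
  ultimately show ?thesis
    using lower_in_filippov_set[OF slip_below[of t]] assms True by auto
next
  case False
  define r where "r = t - \<tau>"
  have r: "0 < r" "r < stick_time" "t = \<tau> + r" using assms False by (auto simp: r_def T_def)
  have "((\<lambda>t. (\<xi> + V * (t - \<tau>), V)) has_vector_derivative (V, 0)) (at t)"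
    by (auto intro!: derivative_eq_intros has_vector_derivative_Pair)
  then have "(lap has_vector_derivative (V, 0)) (at t)"
    by (rule has_vector_derivative_transform_within_open[of _ _ _ "{\<tau><..}"])
      (use r in \<open>auto simp: lap_def\<close>)
  moreover have "(V, 0) \<in> filippov_set (friction_field V c F \<epsilon>) V (lap t)"
  proof -
    have "V * r \<le> V * stick_time" "0 \<le> V * r" using r V_pos by auto
    then have "\<xi> + V * r \<in> {- 1 - \<epsilon> * c * V..1 - \<epsilon> * c * V}"
      using xi unfolding V_stick by auto
    from sliding_in_filippov_set[OF this] show ?thesis
      using lap_stick[of r] r by simp
  qed
  ultimately show ?thesis by blast
qed

lemma solution_orbit: "solution orbit"
  unfolding filippov_solution_def
proof (intro conjI allI impI)
  fix b :: real
  obtain B where "B-lipschitz_on UNIV orbit" by (rule orbit_lipschitz)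
  then have "B-lipschitz_on {0..b} orbit" by (rule lipschitz_on_subset) auto
  then show "absolutely_continuous_interval 0 b orbit"
    by (rule lipschitz_imp_absolutely_continuous_interval)
next
  \<comment> \<open>The instants of the transitions between slip and sliding.\<close>
  define N where "N = range (\<lambda>n::int. n * T) \<union> range (\<lambda>n::int. n * T + \<tau>)"
  have "N \<in> null_sets lborel"
    unfolding N_def by (intro countable_imp_null_set_lborel) auto
  then have "negligible N"
    by (simp add: negligible_iff_null_sets null_sets_completionI)
  then show "AE t in lebesgue. 0 \<le> t \<longrightarrow> (\<exists>v\<in>filippov_set (friction_field V c F \<epsilon>) V (orbit t).
      (orbit has_vector_derivative v) (at t within {0..}))"
  proof (rule AE_lebesgueI_negligible; intro impI)
    fix t assume t: "t \<notin> N"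
    define n where "n = \<lfloor>t / T\<rfloor>"
    define s where "s = T * frac (t / T)"
    have ts: "t = n * T + s" using T_gt by (simp add: s_def n_def frac_def field_simps)
    have s: "s \<in> {0<..<T}" "s \<noteq> \<tau>"
      using frac_bounds[of t] t ts unfolding N_def s_def[symmetric] by (auto simp: less_le)
    then obtain v where v: "v \<in> filippov_set (friction_field V c F \<epsilon>) V (lap s)" "(lap has_vector_derivative v) (at s)"
      using lap_derivative by blast
    have "((\<lambda>r. lap (r - n * T)) has_vector_derivative v) (at t)"
    proof -
      have "(lap \<circ> (\<lambda>r. r - n * T) has_vector_derivative 1 *\<^sub>R v) (at t)"
        by (rule vector_diff_chain_at) (use v(2) ts in \<open>auto intro!: derivative_eq_intros\<close>)
      then show ?thesis by (simp add: o_def)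
    qed
    then have "(orbit has_vector_derivative v) (at t)"
    proof (rule has_vector_derivative_transform_within_open[of _ _ _ "{n * T<..<(n + 1) * T}"])
      show "t \<in> {n * T<..<(n + 1) * T}" using ts s by (simp add: algebra_simps)
      show "lap (r - n * T) = orbit r" if "r \<in> {n * T<..<(n + 1) * T}" for r
      proof -
        have "\<lfloor>r / T\<rfloor> = n" using that T_gt by (intro floor_unique) (auto simp: field_simps)
        then have "T * frac (r / T) = r - n * T"
          using T_gt by (simp add: frac_def right_diff_distrib)
        then show ?thesis by (simp add: orbit_def)
      qed
    qed simp
    then have "(orbit has_vector_derivative v) (at t within {0..})"
      by (rule has_vector_derivative_at_within)
    then show "\<exists>v\<in>filippov_set (friction_field V c F \<epsilon>) V (orbit t). (orbit has_vector_derivative v) (at t within {0..})"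
      using v(1) by (auto simp: orbit_def s_def)
  qed
qed

lemma orbit_0: "orbit 0 = (1 - \<epsilon> * c * V, V)"
  using lap_0 by (simp add: orbit_def)

lemma orbit_tau: "orbit \<tau> = (\<xi>, V)"
  using orbit_eq_lap[of \<tau>] T_gt tau_pos slip_end by (simp add: lap_def)

lemma orbit_sliding:
  assumes "x1 \<in> {\<xi>..1 - \<epsilon> * c * V}"
  shows "(x1, V) = orbit (\<tau> + (x1 - \<xi>) / V)"
proof -
  have "(x1 - \<xi>) / V \<in> {0..stick_time}"
    using assms V_pos by (auto simp: stick_time_def divide_right_mono)
  then show ?thesis
    using orbit_eq_lap[of "\<tau> + (x1 - \<xi>) / V"] lap_stick[of "(x1 - \<xi>) / V"] tau_pos V_pos
    by (auto simp: T_def)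
qed

text \<open>
  The reference instant is the moment when the cycle has covered one third of the sliding segment, and
  the middle third is the time allowed for capture. A radius \<open>\<rho>\<close> is chosen such that a solution that
  is \<open>\<rho>\<close>-close to the cycle during this time reaches the line. Such an instant occurs within two
  periods from any initial phase \<open>s\<close>, which makes the admissible initial distance \<open>d\<close> independent
  of \<open>s\<close>.
\<close>

lemma merges_with_orbit:
  obtains d where "d > 0" "\<And>y s. solution y \<Longrightarrow> s \<ge> 0 \<Longrightarrow> dist (y 0) (orbit s) < d \<Longrightarrow>
    \<exists>a\<ge>0. \<exists>r\<ge>0. \<forall>t\<ge>0. y (a + t) = orbit (r + t)"
proof -
  define A where "A = V * stick_time"
  define \<eta> where "\<eta> = A / 6"
  define h where "h = stick_time / 3"
  \<comment> \<open>The first bound controls the velocity error, the second the time needed to reach the line.\<close>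
  define \<rho> where "\<rho> = min (\<eta> / (1 + M)) (\<eta> * h / 2)"
  have pos: "A > 0" "\<eta> > 0" "h > 0"
    using V_pos stick_pos by (auto simp: A_def \<eta>_def h_def)
  have \<rho>: "\<rho> > 0" "(1 + M) * \<rho> \<le> \<eta>" "\<rho> < \<eta> * h"
  proof -
    show "\<rho> > 0" using pos M_nonneg by (simp add: \<rho>_def)
    have "\<rho> \<le> \<eta> / (1 + M)" unfolding \<rho>_def by (rule min.cobounded1)
    then show "(1 + M) * \<rho> \<le> \<eta>" using M_nonneg by (simp add: field_simps)
    have "\<rho> \<le> \<eta> * h / 2" unfolding \<rho>_def by (rule min.cobounded2)
    moreover have "\<eta> * h > 0" using pos by simp
    ultimately show "\<rho> < \<eta> * h" by linarith
  qed
  have \<rho>\<eta>: "\<rho> \<le> \<eta>" using \<rho> M_nonneg by (smt (verit) mult_le_cancel_right1)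
  define d where "d = \<rho> * exp (- (M * (2 * T)))"
  show thesis
  proof (rule that)
    show "d > 0" using \<rho> by (simp add: d_def)
    fix y s assume y: "solution y" and "s \<ge> 0" and near: "dist (y 0) (orbit s) < d"
    have close: "norm (y t - orbit (s + t)) \<le> \<rho>" if "t \<in> {0..2 * T}" for t
    proof -
      have "norm (y t - orbit (t + s)) \<le> exp (M * t) * norm (y 0 - orbit (0 + s))"
        using solutions_distance_growth[OF y filippov_solution_shift[OF solution_orbit \<open>s \<ge> 0\<close>]] that by auto
      also have "\<dots> \<le> exp (M * (2 * T)) * d"
        using near that M_nonneg by (intro mult_mono) (auto simp: dist_norm intro!: mult_left_mono)
      also have "\<dots> = \<rho>" by (simp add: d_def exp_minus)
      finally show ?thesis by (simp add: add.commute)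
    qed
    define n where "n = nat \<lceil>(s - (\<tau> + h)) / T\<rceil>"
    define a where "a = real n * T + (\<tau> + h) - s"
    have a: "0 \<le> a" "a + h \<le> 2 * T"
    proof -
      have "(s - (\<tau> + h)) / T \<le> real n" unfolding n_def by linarith
      then show "0 \<le> a" using T_gt by (simp add: a_def pos_divide_le_eq)
      have "- 1 \<le> (s - (\<tau> + h)) / T"
        using \<open>s \<ge> 0\<close> T_gt stick_pos by (simp add: pos_le_divide_eq) (simp add: T_def h_def)
      then have "real n \<le> (s - (\<tau> + h)) / T + 1"
        unfolding n_def by linarith
      then have "real n * T \<le> ((s - (\<tau> + h)) / T + 1) * T"
        using T_gt by (intro mult_right_mono) auto
      then have "real n * T \<le> s - (\<tau> + h) + T"
        using T_gt by (simp add: distrib_right)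
      then show "a + h \<le> 2 * T" using T_gt pos(3) tau_pos by (simp add: a_def T_def h_def)
    qed
    have stick: "orbit (s + (a + r)) = (\<xi> + V * (h + r), V)" if "r \<in> {0..h}" for r
    proof -
      have "orbit (s + (a + r)) = orbit (real n * T + (\<tau> + (h + r)))"
        by (simp add: a_def algebra_simps)
      also have "\<dots> = lap (\<tau> + (h + r))"
        unfolding orbit_shift_nat
        by (rule orbit_eq_lap) (use that pos tau_pos in \<open>auto simp: T_def h_def\<close>)
      also have "\<dots> = (\<xi> + V * (h + r), V)"
        using that pos by (intro lap_stick) auto
      finally show ?thesis .
    qed
    have track: "fst (y t) \<in> {\<xi> + A / 3 - \<rho>..\<xi> + 2 * A / 3 + \<rho>} \<and> \<bar>snd (y t) - V\<bar> \<le> \<rho>"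
      if t: "t \<in> {a..a + h}" for t
    proof -
      define r where "r = t - a"
      have r: "r \<in> {0..h}" "t = a + r" using t by (auto simp: r_def)
      have "norm (y t - orbit (s + t)) \<le> \<rho>" using close[of t] t a by auto
      then have "norm (y t - (\<xi> + V * (h + r), V)) \<le> \<rho>" using stick[OF r(1)] r(2) by simp
      then have "\<bar>fst (y t) - (\<xi> + V * (h + r))\<bar> \<le> \<rho>" "\<bar>snd (y t) - V\<bar> \<le> \<rho>"
        using norm_fst_le[of "fst (y t) - (\<xi> + V * (h + r))" "snd (y t) - V"]
          norm_snd_le[of "snd (y t) - V" "fst (y t) - (\<xi> + V * (h + r))"]
        by (simp_all add: minus_prod_def)
      moreover have "V * (h + r) \<ge> A / 3" "V * (h + r) \<le> 2 * A / 3"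
        using r(1) V_pos by (auto simp: A_def h_def mult_left_mono field_simps)
      ultimately show ?thesis by auto
    qed
    have "\<exists>t\<in>{a..a + h}. snd (y t) = V"
    proof (rule reaches_switching_line[OF y a(1)])
      show "\<bar>fst (y t) + \<epsilon> * c * V\<bar> + M * \<bar>snd (y t) - V\<bar> \<le> 1 - \<eta>" if "t \<in> {a..a + h}" for t
      proof -
        have "M * \<bar>snd (y t) - V\<bar> \<le> M * \<rho>" using track[OF that] M_nonneg by (intro mult_left_mono) auto
        moreover have "fst (y t) \<ge> \<xi> + A / 3 - \<rho>" "fst (y t) \<le> \<xi> + 2 * A / 3 + \<rho>"
          using track[OF that] by auto
        then have "fst (y t) + \<epsilon> * c * V \<le> 1 - A / 3 + \<rho>" "- (fst (y t) + \<epsilon> * c * V) \<le> 1 - A / 3 + \<rho>"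
          using xi V_stick unfolding A_def by (auto simp: field_simps)
        then have "\<bar>fst (y t) + \<epsilon> * c * V\<bar> \<le> 1 - A / 3 + \<rho>"
          by (rule abs_leI)
        ultimately show ?thesis using \<rho>(2) by (simp add: \<eta>_def algebra_simps)
      qed
      show "\<bar>snd (y a) - V\<bar> < \<eta> * (a + h - a)" using track[of a] \<rho>(3) pos by auto
    qed (use pos in auto)
    then obtain b where b: "b \<in> {a..a + h}" "snd (y b) = V" by blast
    have "fst (y b) \<in> {\<xi>..1 - \<epsilon> * c * V}"
      using track[OF b(1)] \<rho>\<eta> pos V_stick by (auto simp: A_def \<eta>_def field_simps)
    define r where "r = \<tau> + (fst (y b) - \<xi>) / V"
    have "y b = orbit r"
      using orbit_sliding[OF \<open>fst (y b) \<in> _\<close>] b(2) by (metis prod.collapse r_def)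
    have "0 \<le> b" "0 \<le> r" using a b \<open>fst (y b) \<in> _\<close> V_pos tau_pos by (auto simp: r_def)
    have "y (b + t) = orbit (r + t)" if "t \<ge> 0" for t
      using solution_unique[OF filippov_solution_shift[OF y \<open>0 \<le> b\<close>]
          filippov_solution_shift[OF solution_orbit \<open>0 \<le> r\<close>] _ that] \<open>y b = orbit r\<close>
      by (simp add: add.commute)
    then show "\<exists>a\<ge>0. \<exists>r\<ge>0. \<forall>t\<ge>0. y (a + t) = orbit (r + t)"
      using \<open>0 \<le> b\<close> \<open>0 \<le> r\<close> by blast
  qed
qed

text \<open>
  Finite-time stability measures distances to the trajectory as a set; here a phase is picked.
\<close>

lemma infdist_orbit_less:
  assumes "infdist z (trajectory orbit) < d"
  obtains s where "s \<ge> 0" "dist z (orbit s) < d"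
proof -
  have "Inf (dist z ` trajectory orbit) < d" "trajectory orbit \<noteq> {}"
    using assms by (auto simp: infdist_def trajectory_def split: if_splits)
  then obtain p where "p \<in> trajectory orbit" "dist z p < d"
    using cInf_lessD[of "dist z ` trajectory orbit" d] by auto
  then show thesis using that by (auto simp: trajectory_def)
qed

lemma finite_time_stable_orbit:
  "finite_time_stable (friction_field V c F \<epsilon>) V (trajectory orbit)"
proof -
  obtain d where d: "d > 0" "\<And>y s. solution y \<Longrightarrow> s \<ge> 0 \<Longrightarrow> dist (y 0) (orbit s) < d \<Longrightarrow>
      \<exists>a\<ge>0. \<exists>r\<ge>0. \<forall>t\<ge>0. y (a + t) = orbit (r + t)"
    by (rule merges_with_orbit) blast
  show ?thesis
    unfolding finite_time_stable_def
  proof (rule exI[of _ d], intro conjI allI impI, rule d(1), elim conjE)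
    fix y assume y: "solution y" "infdist (y 0) (trajectory orbit) < d"
    obtain s where "s \<ge> 0" "dist (y 0) (orbit s) < d"
      using infdist_orbit_less[OF y(2)] by blast
    then obtain a r where a: "a \<ge> 0" "r \<ge> 0" "\<And>t. t \<ge> 0 \<Longrightarrow> y (a + t) = orbit (r + t)"
      using d(2)[OF y(1)] by metis
    show "\<exists>T\<ge>0. \<forall>t\<ge>T. y t \<in> trajectory orbit"
    proof (intro exI[of _ a] conjI allI impI a(1))
      fix t assume "t \<ge> a"
      then have "y t = orbit (r + (t - a))" using a(3)[of "t - a"] by simp
      then show "y t \<in> trajectory orbit"
        using \<open>t \<ge> a\<close> a(2) by (auto simp: trajectory_def)
    qed
  qed
qed

lemma orbit_tail: "s \<ge> 0 \<Longrightarrow> t \<ge> 0 \<Longrightarrow> \<exists>r\<ge>s. orbit r = orbit t"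
proof -
  assume "s \<ge> 0" "t \<ge> 0"
  obtain n :: nat where "s / T < real n" using reals_Archimedean2 by blast
  then have "s \<le> real n * T + t" using T_gt \<open>t \<ge> 0\<close> by (simp add: field_simps)
  then show ?thesis using orbit_shift_nat by blast
qed

text \<open>
  A periodic solution that comes close to the cycle merges with it. By periodicity, it has then been
  on the cycle all the time.
\<close>

lemma limit_cycle_orbit: "limit_cycle (friction_field V c F \<epsilon>) V orbit"
proof -
  obtain d where d: "d > 0" "\<And>y s. solution y \<Longrightarrow> s \<ge> 0 \<Longrightarrow> dist (y 0) (orbit s) < d \<Longrightarrow>
      \<exists>a\<ge>0. \<exists>r\<ge>0. \<forall>t\<ge>0. y (a + t) = orbit (r + t)"
    by (rule merges_with_orbit) blast
  define U where "U = {z. infdist z (trajectory orbit) < d}"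
  have "open U"
    unfolding U_def by (intro open_Collect_less continuous_intros)
  moreover have "trajectory orbit \<subseteq> U"
    using d(1) by (auto simp: U_def)
  moreover have "trajectory y = trajectory orbit"
    if y: "nonconstant_periodic_solution (friction_field V c F \<epsilon>) V y" and meet: "trajectory y \<inter> U \<noteq> {}" for y
  proof -
    obtain P where P: "P > 0" "\<And>t. t \<ge> 0 \<Longrightarrow> y (t + P) = y t" and sol: "solution y"
      using y unfolding nonconstant_periodic_solution_def by blast
    have P_nat: "y (t + real n * P) = y t" if "t \<ge> 0" for t n
    proof (induction n)
      case (Suc n)
      have "y (t + real (Suc n) * P) = y ((t + real n * P) + P)" by (simp add: algebra_simps)
      then show ?case using P that Suc by simp
    qed simp
    obtain t0 where t0: "t0 \<ge> 0" "infdist (y t0) (trajectory orbit) < d"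
      using meet by (auto simp: U_def trajectory_def)
    obtain s where s: "s \<ge> 0" "dist (y t0) (orbit s) < d"
      using infdist_orbit_less[OF t0(2)] by blast
    obtain a r where a: "a \<ge> 0" "r \<ge> 0" "\<And>t. t \<ge> 0 \<Longrightarrow> y (t0 + a + t) = orbit (r + t)"
      using d(2)[OF filippov_solution_shift[OF sol t0(1)] s(1)] s(2)
      by (auto simp: algebra_simps)
    show ?thesis
    proof
      show "trajectory y \<subseteq> trajectory orbit"
      proof
        fix z assume "z \<in> trajectory y"
        then obtain t where t: "t \<ge> 0" "z = y t" by (auto simp: trajectory_def)
        obtain n :: nat where "(t0 + a) / P < real n" using reals_Archimedean2 by blast
        then have n: "t0 + a \<le> t + real n * P" using P(1) t(1) by (simp add: field_simps)
        then have "y t = orbit (r + (t + real n * P - (t0 + a)))"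
          using a(3)[of "t + real n * P - (t0 + a)"] P_nat[OF t(1), of n] by simp
        then show "z \<in> trajectory orbit"
          using n t(2) a(2) by (auto simp: trajectory_def)
      qed
      show "trajectory orbit \<subseteq> trajectory y"
      proof
        fix z assume "z \<in> trajectory orbit"
        then obtain t where t: "t \<ge> 0" "z = orbit t" by (auto simp: trajectory_def)
        obtain q where "q \<ge> r" "orbit q = orbit t" using orbit_tail[OF a(2) t(1)] by blast
        then have "y (t0 + a + (q - r)) = z" using a(3)[of "q - r"] t(2) by simp
        then show "z \<in> trajectory y"
          using \<open>q \<ge> r\<close> a(1) t0(1) unfolding trajectory_def by (intro image_eqI[of _ _ "t0 + a + (q - r)"]) auto
      qed
    qed
  qed
  moreover have "nonconstant_periodic_solution (friction_field V c F \<epsilon>) V orbit"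
    unfolding nonconstant_periodic_solution_def
  proof (intro conjI)
    show "\<exists>T>0. \<forall>t\<ge>0. orbit (t + T) = orbit t" using T_gt orbit_shift by blast
    show "\<exists>t\<ge>0. orbit t \<noteq> orbit 0"
      using xi tau_pos by (intro exI[of _ \<tau>]) (auto simp: orbit_0 orbit_tau)
  qed (rule solution_orbit)
  ultimately show ?thesis unfolding limit_cycle_def by blast
qed

end

section \<open>Globally Lipschitz differential equations\<close>

text \<open>
  Picard iteration. Measured with the weight \<open>exp (2 * M * t)\<close>, the distance of consecutive iterates
  is halved in each step, which gives convergence on every bounded interval at once.
\<close>

lemma lipschitz_ode_solution_exists:
  fixes g :: "'a::banach \<Rightarrow> 'a"
  assumes lip: "\<And>u v. norm (g u - g v) \<le> B * norm (u - v)"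
  obtains x where "x 0 = x0"
    "\<And>t. t \<ge> 0 \<Longrightarrow> (x has_vector_derivative g (x t)) (at t within {0..})"
proof -
  define M where "M = max B 1"
  have "M > 0" by (simp add: M_def)
  have lip: "norm (g u - g v) \<le> M * norm (u - v)" for u v
    using order_trans[OF lip[of u v] mult_right_mono[of B M]] by (simp add: M_def)
  have "M-lipschitz_on UNIV g"
    using lip \<open>M > 0\<close> by (intro lipschitz_onI) (auto simp: dist_norm)
  then have g_cont: "continuous_on UNIV g" by (rule lipschitz_on_continuous_on)
  define X where "X = rec_nat (\<lambda>t::real. x0) (\<lambda>_ x t. x0 + integral {0..t} (\<lambda>s. g (x s)))"
  have X0: "X 0 = (\<lambda>t. x0)" and XS: "X (Suc n) = (\<lambda>t. x0 + integral {0..t} (\<lambda>s. g (X n s)))" for n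
    by (simp_all add: X_def)
  have cont: "continuous_on {0..b} (X n)" for n and b :: real
  proof (induction n)
    case (Suc n)
    have "continuous_on {0..b} (\<lambda>s. g (X n s))"
      by (rule continuous_on_compose2[OF g_cont Suc]) simp
    then show ?case
      unfolding XS by (intro continuous_intros indefinite_integral_continuous_1 integrable_continuous_real)
  qed (simp add: X0)
  have gcont: "continuous_on {0..b} (\<lambda>s. g (X n s))" for n and b :: real
    by (rule continuous_on_compose2[OF g_cont cont]) simp
  \<comment> \<open>The constant for the first step, since \<open>t * norm (g x0) \<le> C * exp (2 * M * t)\<close>.\<close>
  define C where "C = norm (g x0) / (2 * M)"
  have bound: "norm (X (Suc n) t - X n t) \<le> C * (1/2) ^ n * exp (2 * M * t)" if "t \<ge> 0" for n t
    using that
  proof (induction n arbitrary: t)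
    case 0
    have "norm (X (Suc 0) t - X 0 t) = (2 * M * t) * C"
      using 0 \<open>M > 0\<close> by (simp add: X0 XS C_def)
    also have "\<dots> \<le> exp (2 * M * t) * C"
    proof (rule mult_right_mono)
      show "2 * M * t \<le> exp (2 * M * t)" using exp_ge_add_one_self[of "2 * M * t"] by linarith
    qed (use \<open>M > 0\<close> in \<open>simp add: C_def\<close>)
    finally show ?case by (simp add: mult.commute)
  next
    case (Suc n)
    have int: "((\<lambda>s. M * (C * (1/2) ^ n * exp (2 * M * s))) has_integral
        C * (1/2) ^ Suc n * exp (2 * M * t) - C * (1/2) ^ Suc n * exp (2 * M * 0)) {0..t}"
      using Suc.prems \<open>M > 0\<close>
      by (intro fundamental_theorem_of_calculus)
        (auto intro!: derivative_eq_intros simp flip: has_real_derivative_iff_has_vector_derivative)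
    have "X (Suc (Suc n)) t - X (Suc n) t
        = integral {0..t} (\<lambda>s. g (X (Suc n) s)) - integral {0..t} (\<lambda>s. g (X n s))"
      using fun_cong[OF XS[of "Suc n"], of t] fun_cong[OF XS[of n], of t] by simp
    also have "\<dots> = integral {0..t} (\<lambda>s. g (X (Suc n) s) - g (X n s))"
      by (intro integral_diff[symmetric] integrable_continuous_real gcont)
    also have "norm \<dots> \<le> integral {0..t} (\<lambda>s. M * (C * (1/2) ^ n * exp (2 * M * s)))"
    proof (rule Henstock_Kurzweil_Integration.integral_norm_bound_integral)
      show "(\<lambda>s. g (X (Suc n) s) - g (X n s)) integrable_on {0..t}"
        by (intro integrable_continuous_real continuous_intros gcont)
      show "norm (g (X (Suc n) s) - g (X n s)) \<le> M * (C * (1/2) ^ n * exp (2 * M * s))"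
        if "s \<in> {0..t}" for s
        using that \<open>M > 0\<close> by (intro order_trans[OF lip] mult_left_mono Suc.IH) auto
    qed (use int in blast)
    also have "\<dots> \<le> C * (1/2) ^ Suc n * exp (2 * M * t)"
      using integral_unique[OF int] \<open>M > 0\<close> by (simp add: C_def)
    finally show ?case .
  qed
  define x where "x t = x0 + (\<Sum>i. X (Suc i) t - X i t)" for t
  have lim: "uniform_limit {0..b} X x sequentially" if "b \<ge> 0" for b
  proof -
    have "uniform_limit {0..b} (\<lambda>n t. \<Sum>i<n. X (Suc i) t - X i t) (\<lambda>t. \<Sum>i. X (Suc i) t - X i t) sequentially"
    proof (rule Weierstrass_m_test)
      show "norm (X (Suc n) t - X n t) \<le> C * exp (2 * M * b) * (1/2) ^ n" if t: "t \<in> {0..b}" for n t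
      proof -
        have "norm (X (Suc n) t - X n t) \<le> C * (1/2) ^ n * exp (2 * M * t)"
          using t by (intro bound) auto
        also have "\<dots> \<le> C * (1/2) ^ n * exp (2 * M * b)"
          using t \<open>M > 0\<close> by (intro mult_left_mono) (auto simp: C_def)
        finally show ?thesis by (simp add: mult_ac)
      qed
      show "summable (\<lambda>n. C * exp (2 * M * b) * (1/2) ^ n)"
        by (intro summable_mult summable_geometric) auto
    qed
    then have "uniform_limit {0..b} (\<lambda>n t. x0 + (\<Sum>i<n. X (Suc i) t - X i t)) x sequentially"
      unfolding x_def by (intro uniform_limit_intros)
    moreover have "x0 + (\<Sum>i<n. X (Suc i) t - X i t) = X n t" for n t
      using sum_lessThan_telescope[of "\<lambda>i. X i t" n] by (simp add: X0)
    ultimately show ?thesis by simp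
  qed
  have x_cont: "continuous_on {0..b} x" if "b \<ge> 0" for b
    by (rule uniform_limit_theorem[OF _ lim[OF that]]) (simp_all add: cont)
  have gx_cont: "continuous_on {0..b} (\<lambda>s. g (x s))" if "b \<ge> 0" for b
    by (rule continuous_on_compose2[OF g_cont x_cont[OF that]]) simp
  have fixpoint: "x t = x0 + integral {0..t} (\<lambda>s. g (x s))" if "t \<ge> 0" for t
  proof (rule LIMSEQ_unique)
    show "(\<lambda>n. X (Suc n) t) \<longlonglongrightarrow> x t"
      using tendsto_uniform_limitI[OF lim[OF that], of t] that LIMSEQ_Suc by auto
    have "uniform_limit {0..t} (\<lambda>n s. g (X n s)) (\<lambda>s. g (x s)) sequentially"
      unfolding uniform_limit_iff
    proof (intro allI impI)
      fix e :: real assume "e > 0"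
      then have "\<forall>\<^sub>F n in sequentially. \<forall>s\<in>{0..t}. dist (X n s) (x s) < e / M"
        using uniform_limitD[OF lim[OF that], of "e / M"] \<open>M > 0\<close> by simp
      then show "\<forall>\<^sub>F n in sequentially. \<forall>s\<in>{0..t}. dist (g (X n s)) (g (x s)) < e"
      proof (rule eventually_mono; intro ballI)
        fix n s assume "\<forall>s\<in>{0..t}. dist (X n s) (x s) < e / M" "s \<in> {0..t}"
        then have "M * norm (X n s - x s) < e"
          using \<open>M > 0\<close> by (simp add: dist_norm field_simps)
        then show "dist (g (X n s)) (g (x s)) < e"
          using lip[of "X n s" "x s"] by (simp add: dist_norm)
      qed
    qed
    from uniform_limit_integral[OF this gcont]
    obtain I J where I: "\<And>n. ((\<lambda>s. g (X n s)) has_integral I n) {0..t}"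
        and J: "((\<lambda>s. g (x s)) has_integral J) {0..t}" and "I \<longlonglongrightarrow> J"
      by auto
    then have "(\<lambda>n. x0 + integral {0..t} (\<lambda>s. g (X n s))) \<longlonglongrightarrow> x0 + integral {0..t} (\<lambda>s. g (x s))"
      unfolding integral_unique[OF I] integral_unique[OF J] by (intro tendsto_intros)
    then show "(\<lambda>n. X (Suc n) t) \<longlonglongrightarrow> x0 + integral {0..t} (\<lambda>s. g (x s))"
      by (simp add: XS)
  qed
  show thesis
  proof (rule that)
    show "x 0 = x0" using fixpoint[of 0] by simp
    fix t :: real assume "t \<ge> 0"
    have d: "((\<lambda>u. x0 + integral {0..u} (\<lambda>s. g (x s))) has_vector_derivative 0 + g (x t)) (at t within {0..t + 1})"
      using \<open>t \<ge> 0\<close> gx_cont[of "t + 1"]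
      by (intro has_vector_derivative_add has_vector_derivative_const integral_has_vector_derivative) auto
    have "(x has_vector_derivative g (x t)) (at t within {0..t + 1})"
    proof (rule has_vector_derivative_transform)
      show "x s = x0 + integral {0..s} (\<lambda>s. g (x s))" if "s \<in> {0..t + 1}" for s
        using that by (intro fixpoint) auto
      show "((\<lambda>u. x0 + integral {0..u} (\<lambda>s. g (x s))) has_vector_derivative g (x t)) (at t within {0..t + 1})"
        using d by simp
    qed (use \<open>t \<ge> 0\<close> in auto)
    moreover have "at t within {0..t + 1} = at t within {0..}"
      using \<open>t \<ge> 0\<close> by (intro at_within_nhd[of t "{..<t + 1}"]) auto
    ultimately show "(x has_vector_derivative g (x t)) (at t within {0..})" by simp
  qed
qed

section \<open>Integrals along nearby curves\<close>

text \<open>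
  By dominated convergence: the integrands are at most \<open>1\<close> and tend to zero with \<open>\<eta>\<close> outside the zero
  set of \<open>p\<close>, which is null.
\<close>

lemma integral_regularized_indicator_small:
  fixes p :: "real \<Rightarrow> real"
  assumes p: "continuous_on {a..b} p" and null: "negligible {t \<in> {a..b}. p t = 0}" and "e > 0"
  obtains \<eta> where "\<eta> > 0" "integral {a..b} (\<lambda>t. \<eta> / ((p t)\<^sup>2 + \<eta>)) < e"
proof -
  define N where "N = {t \<in> {a..b}. p t = 0}"
  define q where "q n t = (1 / real (Suc n)) / ((p t)\<^sup>2 + 1 / real (Suc n))" for n t
  have pos: "(p t)\<^sup>2 + 1 / real (Suc n) > 0" for n t
    by (intro add_nonneg_pos) auto
  have int: "q n integrable_on {a..b}" for n
    unfolding q_def using pos less_imp_neq[OF pos]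
    by (intro integrable_continuous_real continuous_intros p) fastforce
  have intN: "q n integrable_on {a..b} - N" for n
    using int[of n] by (rule integrable_spike_set)
      (use null in \<open>auto simp: N_def intro: negligible_subset\<close>)
  have "(\<lambda>n. integral ({a..b} - N) (q n)) \<longlonglongrightarrow> integral ({a..b} - N) (\<lambda>t. 0)"
  proof (rule dominated_convergence(2)[OF intN])
    show "(\<lambda>t. 1 :: real) integrable_on {a..b} - N"
      using integrable_const_ivl[of "1::real" a b] by (rule integrable_spike_set)
        (use null in \<open>auto simp: N_def intro: negligible_subset\<close>)
    show "norm (q n t) \<le> 1" if "t \<in> {a..b} - N" for n t
      using pos[of t n] by (simp add: q_def divide_simps)
    show "(\<lambda>n. q n t) \<longlonglongrightarrow> 0" if t: "t \<in> {a..b} - N" for t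
    proof -
      have "p t \<noteq> 0" using t by (auto simp: N_def)
      then have "(\<lambda>n. (1 / real (Suc n)) / ((p t)\<^sup>2 + 1 / real (Suc n))) \<longlonglongrightarrow> 0 / ((p t)\<^sup>2 + 0)"
        by (intro tendsto_intros LIMSEQ_Suc[OF lim_1_over_n]) auto
      then show ?thesis by (simp add: q_def)
    qed
  qed
  then have "\<forall>\<^sub>F n in sequentially. integral ({a..b} - N) (q n) < e"
    using \<open>e > 0\<close> by (intro order_tendstoD(2)) auto
  then obtain n where "integral ({a..b} - N) (q n) < e"
    by (auto simp: eventually_sequentially)
  moreover have "integral ({a..b} - N) (q n) = integral {a..b} (q n)"
    by (rule integral_spike_set) (use null in \<open>auto simp: N_def intro: negligible_subset\<close>)
  ultimately show thesis
    using that[of "1 / real (Suc n)"] by (simp add: q_def[abs_def])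
qed

text \<open>
  Let \<open>K\<close> be a primitive of \<open>H\<close>. Then \<open>H (v t) * v' t\<close> is the derivative of \<open>K (v t)\<close>, and \<open>K\<close> is
  Lipschitz with constant \<open>B\<close> however irregular \<open>H\<close> is. So the integral of \<open>H (v t) * v' t * w t\<close>
  depends continuously on \<open>v\<close>, through an integration by parts, whenever the weight \<open>w\<close> is smooth. The
  ideal weight \<open>1 / u'\<close> is singular at the turning points of \<open>u\<close>; it is replaced by the smooth weight
  \<open>u' / (u'\<^sup>2 + \<eta>)\<close>, and the error \<open>\<eta> / (u'\<^sup>2 + \<eta>)\<close> has a small integral for small \<open>\<eta>\<close>.
\<close>

lemma integral_compose_stable:
  fixes u u' u'' :: "real \<Rightarrow> real" and e R :: real
  assumes "a \<le> b"
    and u: "\<And>t. t \<in> {a..b} \<Longrightarrow> (u has_real_derivative u' t) (at t within {a..b})"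
    and u': "\<And>t. t \<in> {a..b} \<Longrightarrow> (u' has_real_derivative u'' t) (at t within {a..b})"
    and u'': "continuous_on {a..b} u''"
    and null: "negligible {t \<in> {a..b}. u' t = 0}"
    and R: "\<And>t. t \<in> {a..b} \<Longrightarrow> \<bar>u t\<bar> + 1 \<le> R"
    and "e > 0"
  obtains \<delta> where "\<delta> > 0"
    "\<And>v v' H B. \<lbrakk>\<And>t. t \<in> {a..b} \<Longrightarrow> (v has_real_derivative v' t) (at t within {a..b});
        \<And>t. t \<in> {a..b} \<Longrightarrow> \<bar>v t - u t\<bar> \<le> \<delta>; \<And>t. t \<in> {a..b} \<Longrightarrow> \<bar>v' t - u' t\<bar> \<le> \<delta>;
        continuous_on {-R..R} H; \<And>y. y \<in> {-R..R} \<Longrightarrow> \<bar>H y\<bar> \<le> B\<rbrakk>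
      \<Longrightarrow> \<bar>integral {a..b} (\<lambda>t. H (v t)) - integral {a..b} (\<lambda>t. H (u t))\<bar> \<le> e * B"
proof -
  have u'_cont: "continuous_on {a..b} u'" and u_cont: "continuous_on {a..b} u"
    by (rule DERIV_continuous_on[OF u'], assumption) (rule DERIV_continuous_on[OF u], assumption)
  obtain \<eta> where \<eta>: "\<eta> > 0" "integral {a..b} (\<lambda>t. \<eta> / ((u' t)\<^sup>2 + \<eta>)) < e / 4"
    using integral_regularized_indicator_small[OF u'_cont null, of "e / 4"] \<open>e > 0\<close> by auto
  have den: "(u' t)\<^sup>2 + \<eta> > 0" for t using \<eta>(1) by (intro add_nonneg_pos) auto
  have den0: "(u' t)\<^sup>2 + \<eta> \<noteq> 0" for t using den[of t] by simp
  define q where "q t = \<eta> / ((u' t)\<^sup>2 + \<eta>)" for t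
  define w where "w t = u' t / ((u' t)\<^sup>2 + \<eta>)" for t
  define w' where "w' t = (u'' t * ((u' t)\<^sup>2 + \<eta>) - u' t * (2 * u' t * u'' t)) / ((u' t)\<^sup>2 + \<eta>)\<^sup>2" for t
  have q: "1 - u' t * w t = q t" "q t \<ge> 0" for t
  proof -
    show "1 - u' t * w t = q t"
      unfolding q_def w_def using den0[of t] by (simp add: diff_eq_eq power2_eq_square flip: add_divide_distrib)
    show "q t \<ge> 0" unfolding q_def using \<eta>(1) den[of t] by simp
  qed
  have w: "(w has_real_derivative w' t) (at t within {a..b})" if "t \<in> {a..b}" for t
    unfolding w_def w'_def using u'[OF that] den0[of t]
    by (auto intro!: derivative_eq_intros simp: power2_eq_square)
  have "continuous_on {a..b} w" "continuous_on {a..b} w'"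
    unfolding w_def w'_def using den0 by (auto intro!: continuous_intros u'_cont u'')
  then have "bounded (w ` {a..b})" "bounded (w' ` {a..b})"
    by (auto intro!: compact_imp_bounded compact_continuous_image)
  then obtain W1 W2 where "\<And>t. t \<in> {a..b} \<Longrightarrow> \<bar>w t\<bar> \<le> W1" "\<And>t. t \<in> {a..b} \<Longrightarrow> \<bar>w' t\<bar> \<le> W2"
    unfolding bounded_iff by (metis imageI real_norm_def)
  then obtain W where W: "W \<ge> 0" "\<And>t. t \<in> {a..b} \<Longrightarrow> \<bar>w t\<bar> \<le> W" "\<And>t. t \<in> {a..b} \<Longrightarrow> \<bar>w' t\<bar> \<le> W"
    by (metis abs_ge_zero max.coboundedI1 max.coboundedI2 max.cobounded1)
  \<comment> \<open>Boundary terms and the integral of the remaining terms, per unit of \<open>\<delta> * B\<close>.\<close>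
  define S where "S = 2 * W + 2 * W * (b - a)"
  have S: "S \<ge> 0" using W(1) \<open>a \<le> b\<close> by (simp add: S_def)
  define \<delta> where "\<delta> = min 1 (e / (2 * (S + 1)))"
  have \<delta>: "\<delta> > 0" "\<delta> \<le> 1" "\<delta> * S \<le> e / 2"
  proof -
    show "\<delta> > 0" "\<delta> \<le> 1" using \<open>e > 0\<close> S by (auto simp: \<delta>_def)
    have "\<delta> * S \<le> e / (2 * (S + 1)) * S"
      using S by (intro mult_right_mono) (auto simp: \<delta>_def)
    also have "\<dots> \<le> e / (2 * (S + 1)) * (S + 1)"
      using S \<open>e > 0\<close> by (intro mult_left_mono) auto
    also have "\<dots> = e / 2" using S by (simp add: field_simps)
    finally show "\<delta> * S \<le> e / 2" .
  qed
  show thesis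
  proof (rule that[OF \<delta>(1)])
    fix v v' H :: "real \<Rightarrow> real" and B :: real
    assume v: "\<And>t. t \<in> {a..b} \<Longrightarrow> (v has_real_derivative v' t) (at t within {a..b})"
      and vu: "\<And>t. t \<in> {a..b} \<Longrightarrow> \<bar>v t - u t\<bar> \<le> \<delta>" and vu': "\<And>t. t \<in> {a..b} \<Longrightarrow> \<bar>v' t - u' t\<bar> \<le> \<delta>"
      and H: "continuous_on {-R..R} H" and B: "\<And>y. y \<in> {-R..R} \<Longrightarrow> \<bar>H y\<bar> \<le> B"
    have v_cont: "continuous_on {a..b} v"
      by (rule DERIV_continuous_on[OF v])
    have uR: "u t \<in> {-R..R}" and vR: "v t \<in> {-R..R}" if "t \<in> {a..b}" for t
      using R[OF that] vu[OF that] \<delta>(2) by auto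
    have "B \<ge> 0"
      using B[of "u a"] uR[of a] \<open>a \<le> b\<close> abs_ge_zero[of "H (u a)"] by auto
    obtain K where K: "\<And>y. y \<in> {-R..R} \<Longrightarrow> (K has_real_derivative H y) (at y within {-R..R})"
      using antiderivative_continuous[OF H] by (auto simp: has_real_derivative_iff_has_vector_derivative)
    have K_lip: "\<bar>K (v t) - K (u t)\<bar> \<le> B * \<delta>" if "t \<in> {a..b}" for t
    proof -
      have "norm (K (v t) - K (u t)) \<le> B * norm (v t - u t)"
        by (rule field_differentiable_bound[OF _ K]) (use B uR[OF that] vR[OF that] in auto)
      also have "\<dots> \<le> B * \<delta>" using vu[OF that] \<open>B \<ge> 0\<close> by (intro mult_left_mono) auto
      finally show ?thesis by simp
    qed
    have chain: "((\<lambda>t. K (g t)) has_real_derivative H (g t) * g' t) (at t within {a..b})"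
      if "\<And>t. t \<in> {a..b} \<Longrightarrow> g t \<in> {-R..R}" "(g has_real_derivative g' t) (at t within {a..b})" "t \<in> {a..b}" for g g' t
    proof -
      have "(K has_real_derivative H (g t)) (at (g t) within g ` {a..b})"
        by (rule DERIV_subset[OF K]) (use that in auto)
      from DERIV_image_chain[OF this that(2)] show ?thesis by (simp add: o_def)
    qed
    \<comment> \<open>The quantity that is integrated by parts.\<close>
    define \<Phi> where "\<Phi> t = (K (v t) - K (u t)) * w t" for t
    define \<Phi>' where "\<Phi>' t = (H (v t) * v' t - H (u t) * u' t) * w t + (K (v t) - K (u t)) * w' t" for t
    have "(\<Phi> has_real_derivative \<Phi>' t) (at t within {a..b})" if t: "t \<in> {a..b}" for t
      unfolding \<Phi>_def \<Phi>'_def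
      using chain[of v v' t, OF vR v[OF t] t] chain[of u u' t, OF uR u[OF t] t] w[OF t]
      by (auto intro!: derivative_eq_intros simp: algebra_simps)
    then have FTC: "(\<Phi>' has_integral \<Phi> b - \<Phi> a) {a..b}"
      using \<open>a \<le> b\<close> by (intro fundamental_theorem_of_calculus) (auto simp flip: has_real_derivative_iff_has_vector_derivative)
    have Hv: "continuous_on {a..b} (\<lambda>t. H (v t))" and Hu: "continuous_on {a..b} (\<lambda>t. H (u t))"
      using uR vR by (auto intro!: continuous_on_compose2[OF H v_cont] continuous_on_compose2[OF H u_cont])
    have q_int: "q integrable_on {a..b}"
      unfolding q_def using den0 by (intro integrable_continuous_real continuous_intros u'_cont) auto
    have pointwise: "\<bar>H (v t) - H (u t) - \<Phi>' t\<bar> \<le> 2 * B * \<delta> * W + 2 * B * q t" if t: "t \<in> {a..b}" for t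
    proof -
      have "H (v t) - H (u t) - \<Phi>' t =
          (H (v t) - H (u t)) * (1 - u' t * w t) - H (v t) * (v' t - u' t) * w t - (K (v t) - K (u t)) * w' t"
        by (simp add: \<Phi>'_def algebra_simps)
      also have "\<bar>\<dots>\<bar> \<le> \<bar>H (v t) - H (u t)\<bar> * q t + \<bar>H (v t)\<bar> * \<bar>v' t - u' t\<bar> * \<bar>w t\<bar>
          + \<bar>K (v t) - K (u t)\<bar> * \<bar>w' t\<bar>"
      proof -
        have tri: "\<bar>x - y - z\<bar> \<le> \<bar>x\<bar> + \<bar>y\<bar> + \<bar>z\<bar>" for x y z :: real by linarith
        show ?thesis
          unfolding q(1) by (rule order_trans[OF tri]) (use q(2)[of t] in \<open>simp add: abs_mult\<close>)
      qed
      also have "\<dots> \<le> (2 * B) * q t + B * \<delta> * W + B * \<delta> * W"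
      proof (intro add_mono)
        have "\<bar>H (v t) - H (u t)\<bar> \<le> 2 * B"
          using B[OF vR[OF t]] B[OF uR[OF t]] by linarith
        then show "\<bar>H (v t) - H (u t)\<bar> * q t \<le> 2 * B * q t"
          by (rule mult_right_mono[OF _ q(2)])
        have "\<bar>H (v t)\<bar> * \<bar>v' t - u' t\<bar> \<le> B * \<delta>"
          using B[OF vR[OF t]] vu'[OF t] \<open>B \<ge> 0\<close> by (rule mult_mono) simp
        then show "\<bar>H (v t)\<bar> * \<bar>v' t - u' t\<bar> * \<bar>w t\<bar> \<le> B * \<delta> * W"
          using W(2)[OF t] by (rule mult_mono) (use \<open>B \<ge> 0\<close> \<delta>(1) in simp_all)
        show "\<bar>K (v t) - K (u t)\<bar> * \<bar>w' t\<bar> \<le> B * \<delta> * W"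
          using K_lip[OF t] W(3)[OF t] \<open>B \<ge> 0\<close> \<delta>(1) by (intro mult_mono) simp_all
      qed
      finally show ?thesis by (simp add: algebra_simps)
    qed
    have ends: "\<bar>\<Phi> t\<bar> \<le> B * \<delta> * W" if t: "t \<in> {a..b}" for t
      unfolding \<Phi>_def abs_mult using K_lip[OF t] W(2)[OF t] W(1) \<delta>(1) \<open>B \<ge> 0\<close>
      by (intro mult_mono) auto
    have "norm (integral {a..b} (\<lambda>t. H (v t) - H (u t) - \<Phi>' t))
        \<le> integral {a..b} (\<lambda>t. 2 * B * \<delta> * W + 2 * B * q t)"
    proof (rule Henstock_Kurzweil_Integration.integral_norm_bound_integral)
      show "(\<lambda>t. H (v t) - H (u t) - \<Phi>' t) integrable_on {a..b}"
        by (intro integrable_diff integrable_continuous_real[OF Hv] integrable_continuous_real[OF Hu]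
            has_integral_integrable[OF FTC])
      show "(\<lambda>t. 2 * B * \<delta> * W + 2 * B * q t) integrable_on {a..b}"
        by (intro integrable_add integrable_on_mult_right q_int) auto
    qed (use pointwise in auto)
    also have "\<dots> = 2 * B * \<delta> * W * (b - a) + 2 * B * integral {a..b} q"
      using q_int \<open>a \<le> b\<close>
      by (subst integral_add) (auto intro!: integrable_on_mult_right)
    also have "\<dots> \<le> 2 * B * \<delta> * W * (b - a) + 2 * B * (e / 4)"
      using \<eta>(2) \<open>B \<ge> 0\<close> by (intro add_left_mono mult_left_mono) (auto simp: q_def[abs_def])
    finally have 1: "\<bar>integral {a..b} (\<lambda>t. H (v t) - H (u t) - \<Phi>' t)\<bar>
        \<le> 2 * B * \<delta> * W * (b - a) + 2 * B * (e / 4)"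
      by simp
    have eq: "integral {a..b} (\<lambda>t. H (v t) - H (u t) - \<Phi>' t)
        = integral {a..b} (\<lambda>t. H (v t)) - integral {a..b} (\<lambda>t. H (u t)) - (\<Phi> b - \<Phi> a)"
      using FTC integrable_continuous_real[OF Hv] integrable_continuous_real[OF Hu]
      by (simp add: integral_diff integrable_diff integral_unique has_integral_integrable)
    have "\<bar>\<Phi> a\<bar> \<le> B * \<delta> * W" "\<bar>\<Phi> b\<bar> \<le> B * \<delta> * W"
      using ends \<open>a \<le> b\<close> by auto
    with 1[unfolded eq]
    have "\<bar>integral {a..b} (\<lambda>t. H (v t)) - integral {a..b} (\<lambda>t. H (u t))\<bar>
        \<le> (2 * B * \<delta> * W * (b - a) + 2 * B * (e / 4)) + B * \<delta> * W + B * \<delta> * W"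
      by linarith
    also have "\<dots> = B * (\<delta> * S) + B * (e / 2)"
      by (simp add: S_def algebra_simps)
    also have "\<dots> \<le> B * (e / 2) + B * (e / 2)"
      using \<delta>(3) \<open>B \<ge> 0\<close> by (intro add_right_mono mult_left_mono)
    finally show "\<bar>integral {a..b} (\<lambda>t. H (v t)) - integral {a..b} (\<lambda>t. H (u t))\<bar> \<le> e * B"
      by (simp add: algebra_simps)
  qed
qed

section \<open>Perturbation of the harmonic oscillator\<close>

text \<open>
  Multiply \<open>E + b\<close> by the integrating factor \<open>exp (- (k * s))\<close>.
\<close>

lemma gronwall_affine:
  fixes E :: "real \<Rightarrow> real"
  assumes "0 \<le> t"
    and E: "\<And>s. s \<in> {0..t} \<Longrightarrow> (E has_real_derivative E' s) (at s within {0..})"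
    and le: "\<And>s. s \<in> {0..t} \<Longrightarrow> E' s \<le> k * (E s + b)"
  shows "E t + b \<le> (E 0 + b) * exp (k * t)"
proof -
  define g where "g s = (E s + b) * exp (- (k * s))" for s
  have g: "(g has_real_derivative (E' s - k * (E s + b)) * exp (- (k * s))) (at s within {0..})"
    if "s \<in> {0..t}" for s
    unfolding g_def using E[OF that] by (auto intro!: derivative_eq_intros simp: algebra_simps)
  have "g t \<le> g 0"
  proof (rule DERIV_nonpos_imp_decreasing_open[OF \<open>0 \<le> t\<close>])
    fix s assume s: "0 < s" "s < t"
    then have "at s within {0..} = at s"
      by (intro at_within_interior) simp
    moreover have "(E' s - k * (E s + b)) * exp (- (k * s)) \<le> 0"
      using le[of s] s by (simp add: mult_le_0_iff)
    ultimately show "\<exists>d. (g has_real_derivative d) (at s) \<and> d \<le> 0"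
      using g[of s] s by auto
  next
    show "continuous_on {0..t} g"
      by (rule DERIV_continuous_on[OF DERIV_subset[OF g]]) auto
  qed
  then have "(E t + b) * exp (- (k * t)) * exp (k * t) \<le> (E 0 + b) * exp (k * t)"
    by (intro mult_right_mono) (auto simp: g_def)
  then show ?thesis by (simp add: mult.assoc flip: exp_add)
qed

text \<open>
  Here \<open>z\<close> and \<open>y\<close> stand for \<open>x\<^sub>1 - 1\<close> and \<open>x\<^sub>2\<close> along the slip arc, so that the unperturbed motion is
  the rotation \<open>(V * sin t, V * cos t)\<close>.
\<close>

locale perturbed_oscillator = friction_oscillator +
  fixes z y :: "real \<Rightarrow> real"
  assumes eps: "0 < \<epsilon>" "\<epsilon> \<le> 1"
    and F_small: "\<And>u. \<bar>F u \<epsilon>\<bar> \<le> L * \<epsilon>"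
    and z_deriv: "\<And>t. t \<ge> 0 \<Longrightarrow> (z has_real_derivative y t) (at t within {0..})"
    and y_deriv: "\<And>t. t \<ge> 0 \<Longrightarrow>
      (y has_real_derivative - z t - \<epsilon> * c * y t + F (y t - V) \<epsilon>) (at t within {0..})"
    and z_start: "z 0 = - (\<epsilon> * c * V)" and y_start: "y 0 = V"
begin

definition "E t = (z t)\<^sup>2 + (y t)\<^sup>2"

lemma E_deriv:
  assumes "t \<ge> 0"
  shows "(E has_real_derivative 2 * y t * (F (y t - V) \<epsilon> - \<epsilon> * c * y t)) (at t within {0..})"
  unfolding E_def using z_deriv[OF assms] y_deriv[OF assms]
  by (auto intro!: derivative_eq_intros simp: algebra_simps)

lemma z_continuous: "continuous_on {0..} z" and y_continuous: "continuous_on {0..} y"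
  by (rule DERIV_continuous_on[OF z_deriv], simp, rule DERIV_continuous_on[OF y_deriv], simp)

lemma force_bound: "\<bar>F (y t - V) \<epsilon> - \<epsilon> * c * y t\<bar> \<le> \<epsilon> * (\<bar>c\<bar> * \<bar>y t\<bar> + L)"
proof -
  have "\<bar>F (y t - V) \<epsilon> - \<epsilon> * c * y t\<bar> \<le> \<bar>F (y t - V) \<epsilon>\<bar> + \<bar>\<epsilon> * c * y t\<bar>" by linarith
  also have "\<dots> \<le> L * \<epsilon> + \<epsilon> * \<bar>c\<bar> * \<bar>y t\<bar>"
    using eps by (intro add_mono F_small) (simp add: abs_mult)
  finally show ?thesis by (simp add: algebra_simps)
qed

end

text \<open>
  Bounds for the amplitude on \<open>[0, 7]\<close> and for the ratio of the drift to \<open>\<epsilon>\<close>. They depend on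
  \<open>V\<close>, \<open>c\<close> and \<open>L\<close> alone, because the range of \<open>\<epsilon>\<close> in the final theorem is chosen in terms of them.
  The time span contains a neighbourhood of one full turn, since \<open>2 * pi + 1 / 2 < 7\<close>.
\<close>

definition amplitude_bound :: "real \<Rightarrow> real \<Rightarrow> real \<Rightarrow> real" where
  "amplitude_bound V c L = sqrt ((V\<^sup>2 + c\<^sup>2 * V\<^sup>2 + 1) * exp ((2 * \<bar>c\<bar> + L) * 7))"

definition drift_bound :: "real \<Rightarrow> real \<Rightarrow> real \<Rightarrow> real" where
  "drift_bound V c L =
    sqrt ((c\<^sup>2 * V\<^sup>2 + (\<bar>c\<bar> * amplitude_bound V c L + L)\<^sup>2) * exp 7)
      + (\<bar>c\<bar> * amplitude_bound V c L + L)"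

context perturbed_oscillator
begin

abbreviation "Y \<equiv> amplitude_bound V c L"

abbreviation "K \<equiv> drift_bound V c L"

lemma Y_nonneg: "Y \<ge> 0" by (simp add: amplitude_bound_def)

text \<open>
  An a priori bound that does not depend on \<open>\<epsilon>\<close>: the energy grows at most exponentially.
\<close>

lemma y_bound: "\<bar>y t\<bar> \<le> Y" if t: "t \<in> {0..7}"
proof -
  have "E t + 1 \<le> (E 0 + 1) * exp ((2 * \<bar>c\<bar> + L) * t)"
  proof (rule gronwall_affine[OF _ E_deriv])
    fix s assume "s \<in> {0..t}"
    have "2 * y s * (F (y s - V) \<epsilon> - \<epsilon> * c * y s) \<le> \<bar>2 * y s\<bar> * \<bar>F (y s - V) \<epsilon> - \<epsilon> * c * y s\<bar>"
      by (metis abs_ge_self abs_mult)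
    also have "\<dots> \<le> \<bar>2 * y s\<bar> * (\<epsilon> * (\<bar>c\<bar> * \<bar>y s\<bar> + L))"
      by (intro mult_left_mono force_bound) auto
    also have "\<dots> \<le> \<bar>2 * y s\<bar> * (1 * (\<bar>c\<bar> * \<bar>y s\<bar> + L))"
      using eps L_nonneg by (intro mult_left_mono mult_right_mono) auto
    also have "\<dots> = 2 * \<bar>c\<bar> * (y s)\<^sup>2 + L * (2 * \<bar>y s\<bar>)"
    proof -
      define a where "a = \<bar>y s\<bar>"
      have "\<bar>2 * y s\<bar> = 2 * a" "(y s)\<^sup>2 = a * a" by (simp_all add: a_def abs_mult power2_eq_square)
      then show ?thesis by (simp add: algebra_simps flip: a_def)
    qed
    also have "\<dots> \<le> 2 * \<bar>c\<bar> * (E s + 1) + L * (E s + 1)"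
    proof (intro add_mono mult_left_mono L_nonneg)
      show "(y s)\<^sup>2 \<le> E s + 1" by (simp add: E_def)
      have "0 \<le> (\<bar>y s\<bar> - 1)\<^sup>2" by simp
      also have "\<dots> = (y s)\<^sup>2 + 1 - 2 * \<bar>y s\<bar>" by (simp add: power2_diff)
      finally show "2 * \<bar>y s\<bar> \<le> E s + 1"
        using zero_le_power2[of "z s"] unfolding E_def by linarith
    qed auto
    finally show "2 * y s * (F (y s - V) \<epsilon> - \<epsilon> * c * y s) \<le> (2 * \<bar>c\<bar> + L) * (E s + 1)"
      by (simp add: algebra_simps)
  qed (use t in auto)
  also have "\<dots> \<le> (V\<^sup>2 + c\<^sup>2 * V\<^sup>2 + 1) * exp ((2 * \<bar>c\<bar> + L) * 7)"
  proof (rule mult_mono)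
    have "\<epsilon>\<^sup>2 * (c\<^sup>2 * V\<^sup>2) \<le> 1 * (c\<^sup>2 * V\<^sup>2)"
      using eps by (intro mult_right_mono) (auto simp: power_le_one)
    then show "E 0 + 1 \<le> V\<^sup>2 + c\<^sup>2 * V\<^sup>2 + 1"
      by (simp add: E_def z_start y_start power_mult_distrib)
    show "exp ((2 * \<bar>c\<bar> + L) * t) \<le> exp ((2 * \<bar>c\<bar> + L) * 7)"
      unfolding exp_le_cancel_iff using t L_nonneg by (intro mult_left_mono) auto
  qed auto
  finally have "(y t)\<^sup>2 \<le> (V\<^sup>2 + c\<^sup>2 * V\<^sup>2 + 1) * exp ((2 * \<bar>c\<bar> + L) * 7)"
    using zero_le_power2[of "z t"] unfolding E_def by linarith
  then show ?thesis
    unfolding amplitude_bound_def using real_sqrt_le_mono by fastforce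
qed

lemma force_small: "\<bar>F (y t - V) \<epsilon> - \<epsilon> * c * y t\<bar> \<le> \<epsilon> * (\<bar>c\<bar> * Y + L)" if "t \<in> {0..7}"
proof -
  have "\<epsilon> * (\<bar>c\<bar> * \<bar>y t\<bar> + L) \<le> \<epsilon> * (\<bar>c\<bar> * Y + L)"
    using y_bound[OF that] eps by (intro mult_left_mono add_right_mono) auto
  then show ?thesis using force_bound[of t] by linarith
qed

text \<open>
  The squared distance to the unperturbed motion is preserved by the rotation, so only the perturbing
  force, which is of order \<open>\<epsilon>\<close>, contributes to its growth. The third estimate compares the derivatives
  of \<open>y\<close> and of \<open>V * cos\<close>; it is needed for the stability of integrals.
\<close>

lemma drift:
  assumes t: "t \<in> {0..7}"
  shows "\<bar>z t - V * sin t\<bar> \<le> K * \<epsilon>" "\<bar>y t - V * cos t\<bar> \<le> K * \<epsilon>"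
    "\<bar>(- z t - \<epsilon> * c * y t + F (y t - V) \<epsilon>) - (- (V * sin t))\<bar> \<le> K * \<epsilon>"
proof -
  define R where "R = \<bar>c\<bar> * Y + L"
  have "R \<ge> 0" using Y_nonneg L_nonneg by (simp add: R_def)
  define D where "D s = (z s - V * sin s)\<^sup>2 + (y s - V * cos s)\<^sup>2" for s
  define D' where "D' s = 2 * (y s - V * cos s) * (F (y s - V) \<epsilon> - \<epsilon> * c * y s)" for s
  have "D t + \<epsilon>\<^sup>2 * R\<^sup>2 \<le> (D 0 + \<epsilon>\<^sup>2 * R\<^sup>2) * exp (1 * t)"
  proof (rule gronwall_affine)
    show "(D has_real_derivative D' s) (at s within {0..})" if "s \<in> {0..t}" for s
      unfolding D_def D'_def using z_deriv[of s] y_deriv[of s] that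
      by (auto intro!: derivative_eq_intros simp: algebra_simps)
    fix s assume s: "s \<in> {0..t}"
    have "D' s \<le> (y s - V * cos s)\<^sup>2 + (F (y s - V) \<epsilon> - \<epsilon> * c * y s)\<^sup>2"
      unfolding D'_def using sum_squares_bound[of "y s - V * cos s"] by simp
    also have "\<dots> \<le> D s + (\<epsilon> * R)\<^sup>2"
    proof (rule add_mono)
      show "(F (y s - V) \<epsilon> - \<epsilon> * c * y s)\<^sup>2 \<le> (\<epsilon> * R)\<^sup>2"
        using force_small[of s] s t by (intro abs_le_square_iff[THEN iffD1]) (auto simp: R_def)
    qed (simp add: D_def)
    finally show "D' s \<le> 1 * (D s + \<epsilon>\<^sup>2 * R\<^sup>2)" by (simp add: power_mult_distrib)
  qed (use t in auto)
  also have "\<dots> \<le> (\<epsilon>\<^sup>2 * (c\<^sup>2 * V\<^sup>2) + \<epsilon>\<^sup>2 * R\<^sup>2) * exp 7"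
    using t by (intro mult_mono) (auto simp: D_def z_start y_start power_mult_distrib)
  also have "\<dots> = \<epsilon>\<^sup>2 * ((c\<^sup>2 * V\<^sup>2 + R\<^sup>2) * exp 7)" by (simp add: algebra_simps)
  finally have "D t \<le> \<epsilon>\<^sup>2 * ((c\<^sup>2 * V\<^sup>2 + R\<^sup>2) * exp 7)"
    using mult_nonneg_nonneg[OF zero_le_power2[of \<epsilon>] zero_le_power2[of R]] by linarith
  then have D: "sqrt (D t) \<le> \<epsilon> * sqrt ((c\<^sup>2 * V\<^sup>2 + R\<^sup>2) * exp 7)"
    using eps real_sqrt_le_mono by (fastforce simp: real_sqrt_mult)
  have K: "K = sqrt ((c\<^sup>2 * V\<^sup>2 + R\<^sup>2) * exp 7) + R" by (simp add: drift_bound_def R_def)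
  have z: "\<bar>z t - V * sin t\<bar> \<le> sqrt (D t)" and y: "\<bar>y t - V * cos t\<bar> \<le> sqrt (D t)"
    unfolding D_def by (auto intro: real_sqrt_sum_squares_ge1 real_sqrt_sum_squares_ge2)
  have "\<epsilon> * R \<ge> 0" using eps \<open>R \<ge> 0\<close> by simp
  then show "\<bar>z t - V * sin t\<bar> \<le> K * \<epsilon>" "\<bar>y t - V * cos t\<bar> \<le> K * \<epsilon>"
    using z y D by (auto simp: K algebra_simps)
  show "\<bar>(- z t - \<epsilon> * c * y t + F (y t - V) \<epsilon>) - (- (V * sin t))\<bar> \<le> K * \<epsilon>"
    using z D force_small[OF t] unfolding K R_def[symmetric] by (auto simp: algebra_simps)
qed

end

section \<open>The energy gained during one turn\<close>

text \<open>
  Dominated convergence: the difference quotients of \<open>F\<close> are bounded by the Lipschitz constant.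
\<close>

lemma force_derivative_tendsto:
  fixes F DF :: "real \<Rightarrow> real \<Rightarrow> real"
  assumes bound: "\<And>u \<epsilon>. \<epsilon> \<ge> 0 \<Longrightarrow> \<bar>F u \<epsilon>\<bar> \<le> L * \<epsilon>"
    and cont: "\<And>\<epsilon>. \<epsilon> \<ge> 0 \<Longrightarrow> continuous_on UNIV (\<lambda>u. F u \<epsilon>)"
    and deriv: "\<And>u. (F u has_real_derivative DF u 0) (at 0 within {0..})"
    and zero: "\<And>u. F u 0 = 0"
  shows "((\<lambda>\<epsilon>. integral {0..2 * pi} (\<lambda>\<tau>. F (V * cos \<tau> - V) \<epsilon> / \<epsilon> * cos \<tau>))
    \<longlongrightarrow> integral {0..2 * pi} (\<lambda>\<tau>. DF (V * cos \<tau> - V) 0 * cos \<tau>)) (at_right 0)"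
proof (rule tendsto_at_right_sequentially[of 0 1])
  fix S :: "nat \<Rightarrow> real"
  assume S: "\<And>n. 0 < S n" "S \<longlonglongrightarrow> 0"
  show "(\<lambda>n. integral {0..2 * pi} (\<lambda>\<tau>. F (V * cos \<tau> - V) (S n) / S n * cos \<tau>))
      \<longlonglongrightarrow> integral {0..2 * pi} (\<lambda>\<tau>. DF (V * cos \<tau> - V) 0 * cos \<tau>)"
  proof (rule dominated_convergence(2)[where h = "\<lambda>_. L"])
    show "(\<lambda>\<tau>. F (V * cos \<tau> - V) (S n) / S n * cos \<tau>) integrable_on {0..2 * pi}" for n
    proof -
      have "S n \<noteq> 0" "S n \<ge> 0" using S(1)[of n] by auto
      then show ?thesis
        by (intro integrable_continuous_real continuous_intros continuous_on_compose2[OF cont]) auto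
    qed
    show "norm (F (V * cos \<tau> - V) (S n) / S n * cos \<tau>) \<le> L" for n \<tau>
    proof -
      have "\<bar>F (V * cos \<tau> - V) (S n)\<bar> / S n \<le> L"
        using bound[of "S n" "V * cos \<tau> - V"] S(1)[of n] by (simp add: pos_divide_le_eq)
      moreover have "\<bar>F (V * cos \<tau> - V) (S n)\<bar> / S n * \<bar>cos \<tau>\<bar> \<le> \<bar>F (V * cos \<tau> - V) (S n)\<bar> / S n * 1"
        using S(1)[of n] by (intro mult_left_mono) auto
      ultimately show ?thesis
        using S(1)[of n] by (simp add: abs_mult)
    qed
    show "(\<lambda>n. F (V * cos \<tau> - V) (S n) / S n * cos \<tau>) \<longlonglongrightarrow> DF (V * cos \<tau> - V) 0 * cos \<tau>" for \<tau>
    proof (intro tendsto_intros)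
      have "((\<lambda>\<epsilon>. F (V * cos \<tau> - V) \<epsilon> / \<epsilon>) \<longlongrightarrow> DF (V * cos \<tau> - V) 0) (at 0 within {0..})"
        using deriv[of "V * cos \<tau> - V"] zero by (simp add: has_field_derivative_iff)
      moreover have "filterlim S (at 0 within {0..}) sequentially"
        using S by (auto simp: filterlim_at less_imp_le less_imp_neq[THEN not_sym])
      ultimately show "(\<lambda>n. F (V * cos \<tau> - V) (S n) / S n) \<longlonglongrightarrow> DF (V * cos \<tau> - V) 0"
        by (rule filterlim_compose)
    qed
  qed auto
qed simp

lemma integral_cos_square: "integral {0..2 * pi} (\<lambda>t. (cos t)\<^sup>2) = pi"
proof -
  have "((\<lambda>t. (cos t)\<^sup>2) has_integral (2 * pi + sin (2 * pi) * cos (2 * pi)) / 2 - (0 + sin 0 * cos 0) / 2) {0..2 * pi}"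
  proof (rule fundamental_theorem_of_calculus)
    show "((\<lambda>t. (t + sin t * cos t) / 2) has_vector_derivative (cos t)\<^sup>2) (at t within {0..2 * pi})" for t :: real
    proof -
      have "(cos t)\<^sup>2 = (1 + ((cos t)\<^sup>2 - (sin t)\<^sup>2)) / 2"
        using sin_squared_eq[of t] by (simp add: field_simps)
      then show ?thesis
        unfolding has_real_derivative_iff_has_vector_derivative[symmetric]
        by (auto intro!: derivative_eq_intros simp: power2_eq_square)
    qed
  qed simp
  then show ?thesis by (simp add: integral_unique)
qed

lemma two_pi_less_7: "2 * pi < 7"
  using pi_approx by simp

context perturbed_oscillator
begin

lemma K_nonneg: "K \<ge> 0"
  using Y_nonneg L_nonneg by (simp add: drift_bound_def)

lemma integral_y_square:
  "\<bar>integral {0..2 * pi} (\<lambda>t. (y t)\<^sup>2) - V\<^sup>2 * pi\<bar> \<le> \<epsilon> * (2 * pi * K * (K + 2 * V))"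
proof -
  have y_int: "(\<lambda>t. (y t)\<^sup>2) integrable_on {0..2 * pi}"
    by (intro integrable_continuous_real continuous_intros continuous_on_subset[OF y_continuous]) auto
  have c_int: "(\<lambda>t. V\<^sup>2 * (cos t)\<^sup>2) integrable_on {0..2 * pi}"
    by (intro integrable_continuous_real continuous_intros)
  have "norm (integral {0..2 * pi} (\<lambda>t. (y t)\<^sup>2 - V\<^sup>2 * (cos t)\<^sup>2))
      \<le> integral {0..2 * pi} (\<lambda>t. K * \<epsilon> * (K + 2 * V))"
  proof (rule Henstock_Kurzweil_Integration.integral_norm_bound_integral)
    fix t assume "t \<in> {0..2 * pi}"
    then have t: "t \<in> {0..7}" using two_pi_less_7 by auto
    note d = drift(2)[OF t]
    have "K * \<epsilon> \<le> K * 1" using K_nonneg eps by (intro mult_left_mono) auto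
    moreover have "\<bar>V * cos t\<bar> \<le> V" using V_pos by (simp add: abs_mult)
    ultimately have "\<bar>y t + V * cos t\<bar> \<le> K + 2 * V"
      using d by linarith
    then have "\<bar>y t - V * cos t\<bar> * \<bar>y t + V * cos t\<bar> \<le> K * \<epsilon> * (K + 2 * V)"
      using d by (intro mult_mono) auto
    moreover have "(y t)\<^sup>2 - V\<^sup>2 * (cos t)\<^sup>2 = (y t - V * cos t) * (y t + V * cos t)"
      by (simp add: power2_eq_square algebra_simps)
    ultimately show "norm ((y t)\<^sup>2 - V\<^sup>2 * (cos t)\<^sup>2) \<le> K * \<epsilon> * (K + 2 * V)"
      by (simp add: abs_mult)
  qed (use y_int c_int in \<open>auto intro: integrable_diff\<close>)
  also have "integral {0..2 * pi} (\<lambda>t. (y t)\<^sup>2 - V\<^sup>2 * (cos t)\<^sup>2)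
      = integral {0..2 * pi} (\<lambda>t. (y t)\<^sup>2) - V\<^sup>2 * pi"
    unfolding integral_diff[OF y_int c_int] integral_mult_right integral_cos_square ..
  also have "integral {0..2 * pi} (\<lambda>t. K * \<epsilon> * (K + 2 * V)) = \<epsilon> * (2 * pi * K * (K + 2 * V))"
    by (simp add: mult_ac)
  finally show ?thesis by simp
qed

lemma energy_after_one_turn:
  "E (2 * pi) = E 0 + 2 * integral {0..2 * pi} (\<lambda>t. y t * F (y t - V) \<epsilon>)
     - 2 * (\<epsilon> * c) * integral {0..2 * pi} (\<lambda>t. (y t)\<^sup>2)"
proof -
  have yc: "continuous_on {0..2 * pi} y"
    using y_continuous by (rule continuous_on_subset) auto
  have int: "((\<lambda>t. 2 * y t * (F (y t - V) \<epsilon> - \<epsilon> * c * y t)) has_integral E (2 * pi) - E 0) {0..2 * pi}"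
    by (rule fundamental_theorem_of_calculus)
      (auto simp flip: has_real_derivative_iff_has_vector_derivative intro!: DERIV_subset[OF E_deriv])
  have eq: "(\<lambda>t. 2 * y t * (F (y t - V) \<epsilon> - \<epsilon> * c * y t))
      = (\<lambda>t. 2 * (y t * F (y t - V) \<epsilon>) - 2 * (\<epsilon> * c) * (y t)\<^sup>2)"
    by (rule ext) (simp add: power2_eq_square algebra_simps)
  have "E (2 * pi) - E 0 = integral {0..2 * pi} (\<lambda>t. 2 * (y t * F (y t - V) \<epsilon>) - 2 * (\<epsilon> * c) * (y t)\<^sup>2)"
    by (rule integral_unique[OF int[unfolded eq], symmetric])
  also have "\<dots> = integral {0..2 * pi} (\<lambda>t. 2 * (y t * F (y t - V) \<epsilon>)) - integral {0..2 * pi} (\<lambda>t. 2 * (\<epsilon> * c) * (y t)\<^sup>2)"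
    by (intro integral_diff integrable_continuous_real continuous_intros yc
        continuous_on_compose2[OF F_continuous[of UNIV]]) auto
  finally show ?thesis by simp
qed

text \<open>
  On the circle, the work of the friction force is \<open>\<epsilon> V\<close> times the integral in the
  assumption \<open>force\<close>, and viscous damping consumes \<open>\<epsilon> c V\<^sup>2 \<pi>\<close>. The assumption \<open>stable\<close> accounts for the
  difference between the orbit and the circle.
\<close>

lemma energy_lower_bound:
  assumes stable: "\<bar>integral {0..2 * pi} (\<lambda>t. y t * F (y t - V) \<epsilon>)
        - integral {0..2 * pi} (\<lambda>t. V * cos t * F (V * cos t - V) \<epsilon>)\<bar> \<le> e * ((V + 1) * (L * \<epsilon>))"
    and force: "integral {0..2 * pi} (\<lambda>t. F (V * cos t - V) \<epsilon> / \<epsilon> * cos t) \<ge> J"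
  shows "E (2 * pi) \<ge> V\<^sup>2 + 2 * \<epsilon> * (V * J - c * V\<^sup>2 * pi - e * ((V + 1) * L)
      - \<epsilon> * (\<bar>c\<bar> * (2 * pi * K * (K + 2 * V))))"
proof -
  let ?I = "integral {0..2 * pi} (\<lambda>t. y t * F (y t - V) \<epsilon>)"
  let ?Q = "integral {0..2 * pi} (\<lambda>t. (y t)\<^sup>2)"
  have "(\<lambda>t. V * cos t * F (V * cos t - V) \<epsilon>) = (\<lambda>t. (\<epsilon> * V) * (F (V * cos t - V) \<epsilon> / \<epsilon> * cos t))"
    using eps by auto
  then have "integral {0..2 * pi} (\<lambda>t. V * cos t * F (V * cos t - V) \<epsilon>)
      = \<epsilon> * V * integral {0..2 * pi} (\<lambda>t. F (V * cos t - V) \<epsilon> / \<epsilon> * cos t)"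
    by (simp only: integral_mult_right)
  also have "\<dots> \<ge> \<epsilon> * V * J"
    using force eps V_pos by (intro mult_left_mono) auto
  finally have 1: "?I \<ge> \<epsilon> * V * J - e * ((V + 1) * (L * \<epsilon>))"
    using stable by linarith
  have 2: "\<epsilon> * c * ?Q \<le> \<epsilon> * (c * (V\<^sup>2 * pi)) + \<epsilon> * (\<bar>c\<bar> * (\<epsilon> * (2 * pi * K * (K + 2 * V))))"
  proof -
    have "c * (?Q - V\<^sup>2 * pi) \<le> \<bar>c\<bar> * \<bar>?Q - V\<^sup>2 * pi\<bar>"
      by (metis abs_ge_self abs_mult)
    also have "\<dots> \<le> \<bar>c\<bar> * (\<epsilon> * (2 * pi * K * (K + 2 * V)))"
      using integral_y_square by (intro mult_left_mono) auto
    finally have "c * ?Q \<le> c * (V\<^sup>2 * pi) + \<bar>c\<bar> * (\<epsilon> * (2 * pi * K * (K + 2 * V)))"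
      by (simp add: algebra_simps)
    then have "\<epsilon> * (c * ?Q) \<le> \<epsilon> * (c * (V\<^sup>2 * pi) + \<bar>c\<bar> * (\<epsilon> * (2 * pi * K * (K + 2 * V))))"
      using eps by (intro mult_left_mono) auto
    then show ?thesis by (simp add: algebra_simps)
  qed
  define A B where "A = \<epsilon> * V * J - e * ((V + 1) * (L * \<epsilon>))"
    and "B = \<epsilon> * (c * (V\<^sup>2 * pi)) + \<epsilon> * (\<bar>c\<bar> * (\<epsilon> * (2 * pi * K * (K + 2 * V))))"
  have "E 0 \<ge> V\<^sup>2" by (simp add: E_def y_start)
  moreover have "E (2 * pi) = E 0 + 2 * ?I - 2 * (\<epsilon> * c * ?Q)"
    using energy_after_one_turn by simp
  ultimately have "E (2 * pi) \<ge> V\<^sup>2 + 2 * A - 2 * B"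
    using 1[folded A_def] 2[folded B_def] by linarith
  then show ?thesis unfolding A_def B_def by (simp add: algebra_simps)
qed

end

text \<open>
  The three error terms of the energy balance (passage from the orbit to the circle in the argument
  of \<open>F\<close>, passage to the limit in the difference quotient, and terms of second order) are each
  made at most \<open>m / 8\<close>, where \<open>2 * \<epsilon> * m\<close> is the gain to first order.
\<close>

lemma energy_gain:
  fixes V c L :: real and F DF :: "real \<Rightarrow> real \<Rightarrow> real"
  assumes V_pos: "V > 0" and L: "L \<ge> 0"
    and bound: "\<And>u \<epsilon>. \<epsilon> \<ge> 0 \<Longrightarrow> \<bar>F u \<epsilon>\<bar> \<le> L * \<epsilon>"
    and cont: "\<And>\<epsilon>. \<epsilon> \<ge> 0 \<Longrightarrow> continuous_on UNIV (\<lambda>u. F u \<epsilon>)"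
    and deriv: "\<And>u. (F u has_real_derivative DF u 0) (at 0 within {0..})"
    and zero: "\<And>u. F u 0 = 0"
    and criterion: "c * V * pi < integral {0..2 * pi} (\<lambda>\<tau>. DF (V * cos \<tau> - V) 0 * cos \<tau>)"
  obtains \<epsilon>0 m where "\<epsilon>0 > 0" "m > 0"
    "\<And>\<epsilon> z y. perturbed_oscillator V c \<epsilon> L F z y \<Longrightarrow> \<epsilon> < \<epsilon>0 \<Longrightarrow>
      (z (2 * pi))\<^sup>2 + (y (2 * pi))\<^sup>2 \<ge> V\<^sup>2 + \<epsilon> * m"
proof -
  define I where "I = integral {0..2 * pi} (\<lambda>\<tau>. DF (V * cos \<tau> - V) 0 * cos \<tau>)"
  define m where "m = V * (I - c * V * pi)"
  have "I - c * V * pi > 0" using criterion unfolding I_def by linarith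
  then have m: "m > 0" unfolding m_def by (rule mult_pos_pos[OF V_pos])
  define K where "K = drift_bound V c L"
  have K: "K \<ge> 0" using L by (simp add: K_def drift_bound_def amplitude_bound_def)
  \<comment> \<open>On \<open>{-(V + 1)..V + 1}\<close>, the integrand \<open>w * F (w - V) \<epsilon>\<close> is bounded by \<open>(V + 1) * L * \<epsilon>\<close>.\<close>
  define e where "e = m / (8 * ((V + 1) * L + 1))"
  have VL: "(V + 1) * L \<ge> 0" using V_pos L by simp
  have e: "e > 0" "e * ((V + 1) * L) \<le> m / 8"
  proof -
    show "e > 0" using m VL by (simp add: e_def)
    then have "e * ((V + 1) * L) \<le> e * ((V + 1) * L + 1)" by (intro mult_left_mono) auto
    also have "\<dots> = m / 8" using VL by (simp add: e_def field_simps)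
    finally show "e * ((V + 1) * L) \<le> m / 8" .
  qed
  obtain \<delta> where \<delta>: "\<delta> > 0" "\<And>v v' H B. \<lbrakk>\<And>t. t \<in> {0..2 * pi} \<Longrightarrow> (v has_real_derivative v' t) (at t within {0..2 * pi});
        \<And>t. t \<in> {0..2 * pi} \<Longrightarrow> \<bar>v t - V * cos t\<bar> \<le> \<delta>;
        \<And>t. t \<in> {0..2 * pi} \<Longrightarrow> \<bar>v' t - (- (V * sin t))\<bar> \<le> \<delta>;
        continuous_on {-(V + 1)..V + 1} H; \<And>y. y \<in> {-(V + 1)..V + 1} \<Longrightarrow> \<bar>H y\<bar> \<le> B\<rbrakk>
      \<Longrightarrow> \<bar>integral {0..2 * pi} (\<lambda>t. H (v t)) - integral {0..2 * pi} (\<lambda>t. H (V * cos t))\<bar> \<le> e * B"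
  proof (rule integral_compose_stable[of 0 "2 * pi" "\<lambda>t. V * cos t" "\<lambda>t. - (V * sin t)" "\<lambda>t. - (V * cos t)" "V + 1" e])
    show "negligible {t \<in> {0..2 * pi}. - (V * sin t) = 0}"
    proof (rule negligible_subset)
      have "range (\<lambda>i::int. of_int i * pi) \<in> null_sets lborel"
        by (intro countable_imp_null_set_lborel) auto
      then show "negligible (range (\<lambda>i::int. of_int i * pi))"
        by (simp add: negligible_iff_null_sets null_sets_completionI)
      show "{t \<in> {0..2 * pi}. - (V * sin t) = 0} \<subseteq> range (\<lambda>i::int. of_int i * pi)"
        using V_pos sin_zero_iff_int2 by auto
    qed
    show "\<bar>V * cos t\<bar> + 1 \<le> V + 1" for t
      using V_pos by (simp add: abs_mult)
  qed (use e in \<open>auto intro!: derivative_eq_intros continuous_intros\<close>)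
  have "\<forall>\<^sub>F \<epsilon> in at_right 0. I - m / (8 * V) < integral {0..2 * pi} (\<lambda>\<tau>. F (V * cos \<tau> - V) \<epsilon> / \<epsilon> * cos \<tau>)"
    unfolding I_def
    by (rule order_tendstoD(1), rule force_derivative_tendsto[of F L DF V])
      (use bound cont deriv zero m V_pos in auto)
  then obtain \<epsilon>1 where \<epsilon>1: "\<epsilon>1 > 0" "\<And>\<epsilon>. 0 < \<epsilon> \<Longrightarrow> \<epsilon> < \<epsilon>1 \<Longrightarrow>
      I - m / (8 * V) < integral {0..2 * pi} (\<lambda>\<tau>. F (V * cos \<tau> - V) \<epsilon> / \<epsilon> * cos \<tau>)"
    unfolding eventually_at_right_field by auto
  define G where "G = \<bar>c\<bar> * (2 * pi * K * (K + 2 * V))"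
  have G: "G \<ge> 0" using K V_pos by (simp add: G_def)
  define \<epsilon>0 where "\<epsilon>0 = min \<epsilon>1 (min (\<delta> / (K + 1)) (m / (8 * (G + 1))))"
  show thesis
  proof (rule that[OF _ m])
    show "\<epsilon>0 > 0" using \<epsilon>1 \<delta>(1) m K G by (simp add: \<epsilon>0_def)
    fix \<epsilon> z y assume "perturbed_oscillator V c \<epsilon> L F z y" and small: "\<epsilon> < \<epsilon>0"
    then interpret perturbed_oscillator V c \<epsilon> L F z y by simp
    have "\<epsilon> < \<delta> / (K + 1)" "\<epsilon> < m / (8 * (G + 1))" "\<epsilon> < \<epsilon>1"
      using small by (auto simp: \<epsilon>0_def)
    then have "\<epsilon> * (K + 1) < \<delta>" "\<epsilon> * (8 * (G + 1)) < m"
      using K G by (simp_all add: pos_less_divide_eq)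
    then have \<epsilon>: "K * \<epsilon> \<le> \<delta>" "\<epsilon> * G \<le> m / 8"
      using eps by (auto simp: algebra_simps)
    have stable: "\<bar>integral {0..2 * pi} (\<lambda>t. y t * F (y t - V) \<epsilon>)
        - integral {0..2 * pi} (\<lambda>t. V * cos t * F (V * cos t - V) \<epsilon>)\<bar> \<le> e * ((V + 1) * (L * \<epsilon>))"
    proof (rule \<delta>(2)[of y "\<lambda>t. - z t - \<epsilon> * c * y t + F (y t - V) \<epsilon>" "\<lambda>w. w * F (w - V) \<epsilon>"])
      fix t assume t: "t \<in> {0..2 * pi}"
      then have t7: "t \<in> {0..7}" using two_pi_less_7 by auto
      show "(y has_real_derivative - z t - \<epsilon> * c * y t + F (y t - V) \<epsilon>) (at t within {0..2 * pi})"
        by (rule DERIV_subset[OF y_deriv]) (use t in auto)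
      show "\<bar>y t - V * cos t\<bar> \<le> \<delta>" "\<bar>- z t - \<epsilon> * c * y t + F (y t - V) \<epsilon> - (- (V * sin t))\<bar> \<le> \<delta>"
        using drift(2,3)[OF t7] \<epsilon>(1) unfolding K_def by linarith+
    next
      show "continuous_on {-(V + 1)..V + 1} (\<lambda>w. w * F (w - V) \<epsilon>)"
        by (intro continuous_intros continuous_on_compose2[OF F_continuous[of UNIV]]) auto
      show "\<bar>w * F (w - V) \<epsilon>\<bar> \<le> (V + 1) * (L * \<epsilon>)" if "w \<in> {-(V + 1)..V + 1}" for w
        unfolding abs_mult using that F_small V_pos by (intro mult_mono) auto
    qed
    have "I - m / (8 * V) \<le> integral {0..2 * pi} (\<lambda>\<tau>. F (V * cos \<tau> - V) \<epsilon> / \<epsilon> * cos \<tau>)"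
      using \<epsilon>1(2)[of \<epsilon>] eps \<open>\<epsilon> < \<epsilon>1\<close> by simp
    note lower_bound = energy_lower_bound[OF stable this]
    have "V * (I - m / (8 * V)) = V * I - m / 8"
      using V_pos by (simp add: right_diff_distrib)
    moreover have "V * I - c * V\<^sup>2 * pi = m"
      by (simp add: m_def power2_eq_square algebra_simps)
    ultimately have "V * (I - m / (8 * V)) - c * V\<^sup>2 * pi = m - m / 8"
      by linarith
    then have "E (2 * pi) \<ge> V\<^sup>2 + 2 * \<epsilon> * (m - m / 8 - e * ((V + 1) * L) - \<epsilon> * G)"
      using lower_bound by (simp only: G_def K_def)
    moreover have "2 * \<epsilon> * (m - m / 8 - e * ((V + 1) * L) - \<epsilon> * G) \<ge> 2 * \<epsilon> * (m / 2)"
      using e(2) \<epsilon>(2) eps m by (intro mult_left_mono) auto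
    ultimately show "(z (2 * pi))\<^sup>2 + (y (2 * pi))\<^sup>2 \<ge> V\<^sup>2 + \<epsilon> * m"
      by (simp add: E_def)
  qed
qed

section \<open>Return to the switching line\<close>

lemma last_exit:
  fixes f :: "real \<Rightarrow> real"
  assumes "a \<le> b" "continuous_on {a..b} f" "f a \<ge> 0" "f b < 0"
  obtains s where "s \<in> {a..<b}" "f s = 0" "\<And>t. t \<in> {s<..b} \<Longrightarrow> f t < 0"
proof -
  define Z where "Z = {a..b} \<inter> f -` {0..}"
  have "closed Z"
    unfolding Z_def by (intro continuous_closed_preimage assms(2)) auto
  moreover have "bounded Z"
    by (rule bounded_subset[of "{a..b}"]) (auto simp: Z_def)
  ultimately have "compact Z" unfolding compact_eq_bounded_closed by blast
  moreover have "a \<in> Z" using assms by (auto simp: Z_def)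
  ultimately obtain s where s: "s \<in> Z" "\<And>t. t \<in> Z \<Longrightarrow> t \<le> s"
    using compact_attains_sup[of Z] by auto
  have "s \<noteq> b" using s(1) assms(4) by (auto simp: Z_def)
  then have sab: "s \<in> {a..<b}" using s(1) by (auto simp: Z_def)
  have neg: "f t < 0" if "t \<in> {s<..b}" for t
    using s(2)[of t] sab that by (force simp: Z_def)
  have "f s = 0"
  proof (rule ccontr)
    assume "f s \<noteq> 0"
    then have "f s > 0" using s(1) by (simp add: Z_def)
    moreover have "continuous_on {s..b} f"
      using assms(2) by (rule continuous_on_subset) (use sab in auto)
    ultimately obtain t where "s \<le> t" "t \<le> b" "f t = 0"
      using IVT2'[of f b 0 s] assms(4) sab by auto
    then show False using neg[of t] \<open>f s > 0\<close> by (cases "t = s") auto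
  qed
  then show thesis using that sab neg by blast
qed

lemma first_entry:
  fixes f :: "real \<Rightarrow> real"
  assumes "a \<le> b" "continuous_on {a..b} f" "f a < 0" "f b \<ge> 0"
  obtains s where "s \<in> {a<..b}" "f s = 0" "\<And>t. t \<in> {a..<s} \<Longrightarrow> f t < 0"
proof -
  obtain s where s: "s \<in> {-b..<-a}" "f (- s) = 0" "\<And>t. t \<in> {s<..-a} \<Longrightarrow> f (- t) < 0"
  proof (rule last_exit[of "-b" "-a" "\<lambda>t. f (- t)"])
    show "continuous_on {-b..-a} (\<lambda>t. f (- t))"
      by (rule continuous_on_compose2[OF assms(2)]) (auto intro!: continuous_intros)
  qed (use assms in auto)
  show thesis
  proof (rule that[of "- s"])
    show "f t < 0" if "t \<in> {a..<- s}" for t using s(3)[of "- t"] that by auto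
  qed (use s in auto)
qed

lemma nondecreasing_of_deriv_nonneg:
  fixes f :: "real \<Rightarrow> real"
  assumes "0 \<le> a" "a \<le> b"
    and f: "\<And>t. t \<ge> 0 \<Longrightarrow> (f has_real_derivative f' t) (at t within {0..})"
    and nonneg: "\<And>t. t \<in> {a<..<b} \<Longrightarrow> f' t \<ge> 0"
  shows "f a \<le> f b"
proof (rule DERIV_nonneg_imp_increasing_open[OF \<open>a \<le> b\<close>])
  fix t assume t: "a < t" "t < b"
  then have "at t within {0..} = at t"
    using \<open>0 \<le> a\<close> by (intro at_within_interior) simp
  then show "\<exists>d. (f has_real_derivative d) (at t) \<and> d \<ge> 0"
    using f[of t] nonneg[of t] t \<open>0 \<le> a\<close> by auto
next
  have "continuous_on {0..} f" by (rule DERIV_continuous_on[OF f]) simp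
  then show "continuous_on {a..b} f" by (rule continuous_on_subset) (use \<open>0 \<le> a\<close> in auto)
qed

lemma cos_le_cos_far:
  assumes "0 \<le> \<sigma>" "\<sigma> \<le> t" "t \<le> 2 * pi - \<sigma>"
  shows "cos t \<le> cos \<sigma>"
proof (cases "t \<le> pi")
  case True
  then show ?thesis using assms by (intro cos_monotone_0_pi_le) auto
next
  case False
  then have "cos (2 * pi - t) \<le> cos \<sigma>" using assms by (intro cos_monotone_0_pi_le) auto
  then show ?thesis by (simp add: cos_diff)
qed

context perturbed_oscillator
begin

text \<open>
  The orbit starts tangentially to the line, so the unperturbed motion does not decide on which side it
  continues. While \<open>y\<close> is positive, \<open>z\<close> increases beyond its initial value \<open>- \<epsilon> c V\<close>, at which the
  vertical velocity on the line vanishes; so above the line the vertical velocity is at most \<open>M\<close> times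
  the height, and a solution that starts on the line cannot rise.
\<close>

lemma stays_below_initially:
  assumes small: "K * \<epsilon> < V * cos 1" and t: "t \<in> {0..1}"
  shows "y t \<le> V"
proof (rule ccontr)
  assume "\<not> ?thesis"
  then have "V - y t < 0" by simp
  have y_pos: "y s > 0" if "s \<in> {0..1}" for s
  proof -
    have "cos 1 \<le> cos s" using that pi_gt3 by (intro cos_monotone_0_pi_le) auto
    then have "V * cos 1 \<le> V * cos s" using V_pos by simp
    then show ?thesis using drift(2)[of s] that small by auto
  qed
  obtain s where s: "s \<in> {0..<t}" "V - y s = 0" "\<And>r. r \<in> {s<..t} \<Longrightarrow> V - y r < 0"
  proof (rule last_exit[of 0 t "\<lambda>t. V - y t"])
    show "continuous_on {0..t} (\<lambda>t. V - y t)"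
      by (intro continuous_intros continuous_on_subset[OF y_continuous]) auto
  qed (use t \<open>V - y t < 0\<close> y_start in auto)
  define g where "g r = (V - y r) * exp (- (M * r))" for r
  define g' where "g' r = (z r + \<epsilon> * c * y r - F (y r - V) \<epsilon> - M * (V - y r)) * exp (- (M * r))" for r
  have "g s \<le> g t"
  proof (rule nondecreasing_of_deriv_nonneg[of s t g g'])
    show "(g has_real_derivative g' r) (at r within {0..})" if "r \<ge> 0" for r
      unfolding g_def g'_def using y_deriv[OF that]
      by (auto intro!: derivative_eq_intros simp: algebra_simps)
    fix r assume r: "r \<in> {s<..<t}"
    have r0: "r \<ge> 0" using r s(1) by auto
    have "z 0 \<le> z r"
      by (rule nondecreasing_of_deriv_nonneg[of 0 r z y, OF _ r0 z_deriv]) (use y_pos r t in \<open>auto intro: less_imp_le\<close>)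
    then have "z r + \<epsilon> * c * V \<ge> 0" by (simp add: z_start)
    moreover have "V - y r < 0" using s(3)[of r] r by auto
    moreover have "\<epsilon> * c * (V - y r) \<le> \<bar>\<epsilon> * c\<bar> * \<bar>V - y r\<bar>"
      by (metis abs_ge_self abs_mult)
    moreover have "\<bar>F (y r - V) \<epsilon>\<bar> \<le> L * \<bar>V - y r\<bar>"
      using F_bound[of "y r - V"] by (simp add: abs_minus_commute)
    ultimately have "z r + \<epsilon> * c * y r - F (y r - V) \<epsilon> - M * (V - y r) \<ge> 0"
      by (simp add: M_def algebra_simps)
    then show "g' r \<ge> 0" by (simp add: g'_def)
  qed (use s(1) in auto)
  then have "(V - y t) * exp (- (M * t)) \<ge> 0" using s(2) by (simp add: g_def)
  with \<open>V - y t < 0\<close> show False by (simp add: zero_le_mult_iff)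
qed

text \<open>
  The velocity of the energy is of order \<open>\<epsilon>\<close>; so on a short interval around \<open>2 * pi\<close>, whose length
  does not depend on \<open>\<epsilon>\<close>, only a fraction of the gain can be lost.
\<close>

lemma energy_near_full_turn:
  assumes "t \<in> {2 * pi - \<sigma>..2 * pi + \<sigma>}" and \<sigma>: "0 < \<sigma>" "\<sigma> \<le> 1 / 2"
  shows "\<bar>E t - E (2 * pi)\<bar> \<le> \<epsilon> * (2 * Y * (\<bar>c\<bar> * Y + L)) * \<sigma>"
proof -
  define S where "S = {2 * pi - \<sigma>..2 * pi + \<sigma>}"
  have S7: "S \<subseteq> {0..7}" using \<sigma> pi_approx by (auto simp: S_def)
  have R: "\<bar>c\<bar> * Y + L \<ge> 0" using Y_nonneg L_nonneg by simp
  have "norm (E t - E (2 * pi)) \<le> (\<epsilon> * (2 * Y * (\<bar>c\<bar> * Y + L))) * norm (t - 2 * pi)"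
  proof (rule field_differentiable_bound[of S E])
    fix s assume s: "s \<in> S"
    then show "(E has_field_derivative 2 * y s * (F (y s - V) \<epsilon> - \<epsilon> * c * y s)) (at s within S)"
      using S7 by (intro DERIV_subset[OF E_deriv]) auto
    have "\<bar>2 * y s\<bar> * \<bar>F (y s - V) \<epsilon> - \<epsilon> * c * y s\<bar> \<le> (2 * Y) * (\<epsilon> * (\<bar>c\<bar> * Y + L))"
      using y_bound[of s] force_small[of s] s S7 Y_nonneg by (intro mult_mono) auto
    then show "norm (2 * y s * (F (y s - V) \<epsilon> - \<epsilon> * c * y s)) \<le> \<epsilon> * (2 * Y * (\<bar>c\<bar> * Y + L))"
      by (simp only: real_norm_def abs_mult mult_ac)
  qed (use assms in \<open>auto simp: S_def\<close>)
  also have "\<dots> \<le> \<epsilon> * (2 * Y * (\<bar>c\<bar> * Y + L)) * \<sigma>"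
    using assms(1) eps Y_nonneg R by (intro mult_left_mono) auto
  finally show ?thesis by simp
qed

text \<open>
  Close to time \<open>2 * pi\<close> the coordinate \<open>z\<close> changes its sign. At the moment \<open>s\<close> when it vanishes, all the
  energy is in \<open>y\<close>, and since the energy exceeds \<open>V\<^sup>2\<close>, the orbit must have crossed the line before, at
  \<open>\<tau>\<close>. There \<open>z\<close> is negative and its square is at least \<open>\<epsilon> * (m / 2)\<close>, hence larger than the square
  of \<open>\<epsilon> c V\<close>, which is of second order.
\<close>

lemma return_to_line:
  assumes gain: "E (2 * pi) \<ge> V\<^sup>2 + \<epsilon> * m" and "m > 0"
    and \<sigma>: "0 < \<sigma>" "\<sigma> \<le> 1 / 2" "V * \<sigma> \<le> 1 / 2" "2 * Y * (\<bar>c\<bar> * Y + L) * \<sigma> \<le> m / 2"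
    and small: "K * \<epsilon> < V * cos 1" "K * \<epsilon> < V * sin \<sigma>" "K * \<epsilon> < V * (1 - cos \<sigma>)"
      "K * \<epsilon> < 1 / 2" "\<epsilon> * (\<bar>c\<bar> * V) < 1" "\<epsilon> * (c\<^sup>2 * V\<^sup>2) < m / 2"
  obtains \<tau> where "\<tau> > 0" "y \<tau> = V" "\<And>t. t \<in> {0..\<tau>} \<Longrightarrow> y t \<le> V"
    "z \<tau> \<in> {- 2 - \<epsilon> * c * V<..<- (\<epsilon> * c * V)}"
proof -
  let ?a = "2 * pi - \<sigma>" and ?b = "2 * pi + \<sigma>"
  have ab: "?a \<le> ?b" "?a > 1" "{?a..?b} \<subseteq> {0..7}" using \<sigma> pi_approx by auto
  have a7: "?a \<in> {0..7}" and b7: "?b \<in> {0..7}" using ab by auto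
  have energy: "E t \<ge> V\<^sup>2 + \<epsilon> * (m / 2)" if "t \<in> {?a..?b}" for t
  proof -
    have "\<epsilon> * (2 * Y * (\<bar>c\<bar> * Y + L) * \<sigma>) \<le> \<epsilon> * (m / 2)"
      using \<sigma>(4) eps by (intro mult_left_mono) auto
    moreover have "\<epsilon> * m = \<epsilon> * (m / 2) + \<epsilon> * (m / 2)" by (simp add: field_simps)
    moreover have "\<bar>E t - E (2 * pi)\<bar> \<le> \<epsilon> * (2 * Y * (\<bar>c\<bar> * Y + L) * \<sigma>)"
      using energy_near_full_turn[OF that \<sigma>(1,2)] by (simp only: mult.assoc)
    ultimately show ?thesis using gain by linarith
  qed
  have trig: "sin ?a = - sin \<sigma>" "sin ?b = sin \<sigma>" "cos ?a = cos \<sigma>"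
    unfolding sin_diff cos_diff sin_add by simp_all
  have y_pos: "y t > 0" if t: "t \<in> {?a..?b}" for t
  proof -
    have "cos 1 \<le> cos \<bar>t - 2 * pi\<bar>"
      using t \<sigma> pi_gt3 by (intro cos_monotone_0_pi_le) auto
    also have "\<dots> = cos t" by (simp add: cos_diff)
    finally have "V * cos 1 \<le> V * cos t" using V_pos by simp
    moreover have "t \<in> {0..7}" using t ab by auto
    ultimately show ?thesis using drift(2)[of t] small(1) by auto
  qed
  have cont: "continuous_on {?a..?b} z" "continuous_on {?a..?b} y"
    using ab by (auto intro: continuous_on_subset[OF z_continuous] continuous_on_subset[OF y_continuous])
  have "z ?a \<le> 0" "z ?b \<ge> 0"
    using drift(1)[OF a7] drift(1)[OF b7] small(2) unfolding trig by auto
  then obtain s where s: "?a \<le> s" "s \<le> ?b" "z s = 0"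
    using IVT'[of z ?a 0 ?b] ab(1) cont(1) by blast
  have "V < y s"
  proof -
    have "(y s)\<^sup>2 \<ge> V\<^sup>2 + \<epsilon> * (m / 2)"
      using energy[of s] s by (simp add: E_def)
    moreover have "\<epsilon> * (m / 2) > 0" using eps \<open>m > 0\<close> by simp
    ultimately have "V\<^sup>2 < (y s)\<^sup>2" by linarith
    then show ?thesis using y_pos[of s] s by (intro power_less_imp_less_base[of V 2]) auto
  qed
  have below: "y t < V" if t: "t \<in> {\<sigma>..?a}" for t
  proof -
    have "V * cos t \<le> V * cos \<sigma>"
      using cos_le_cos_far[of \<sigma> t] t \<sigma>(1) V_pos by simp
    moreover have "t \<in> {0..7}" using t \<sigma>(1) a7 by auto
    moreover have "K * \<epsilon> < V - V * cos \<sigma>" using small(3) by (simp add: algebra_simps)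
    ultimately show ?thesis using drift(2)[of t] by auto
  qed
  obtain \<tau> where \<tau>: "\<tau> \<in> {?a<..s}" "y \<tau> - V = 0" "\<And>t. t \<in> {?a..<\<tau>} \<Longrightarrow> y t - V < 0"
  proof (rule first_entry[of ?a s "\<lambda>t. y t - V"])
    show "continuous_on {?a..s} (\<lambda>t. y t - V)"
      by (intro continuous_intros continuous_on_subset[OF cont(2)]) (use s in auto)
    show "y ?a - V < 0" using below[of ?a] \<sigma> pi_gt3 by auto
  qed (use s \<open>V < y s\<close> in auto)
  have \<tau>ab: "\<tau> \<in> {?a..?b}" using \<tau>(1) s by auto
  have "z \<tau> \<le> z s"
    by (rule nondecreasing_of_deriv_nonneg[of \<tau> s z y, OF _ _ z_deriv])
      (use \<tau>(1) s ab y_pos in \<open>auto intro: less_imp_le\<close>)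
  then have "z \<tau> \<le> 0" using s(3) by simp
  have "(z \<tau>)\<^sup>2 \<ge> \<epsilon> * (m / 2)"
    using energy[OF \<tau>ab] \<tau>(2) by (simp add: E_def)
  moreover have "\<epsilon> * (\<epsilon> * (c\<^sup>2 * V\<^sup>2)) < \<epsilon> * (m / 2)"
    using small(6) eps by (intro mult_strict_left_mono) auto
  moreover have "(\<epsilon> * c * V)\<^sup>2 = \<epsilon> * (\<epsilon> * (c\<^sup>2 * V\<^sup>2))"
    by (simp add: power_mult_distrib power2_eq_square)
  ultimately have "(\<epsilon> * c * V)\<^sup>2 < (z \<tau>)\<^sup>2" by linarith
  then have "\<bar>\<epsilon> * c * V\<bar> < \<bar>z \<tau>\<bar>" using abs_le_square_iff[of "z \<tau>" "\<epsilon> * c * V"] by linarith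
  then have left: "z \<tau> < - (\<epsilon> * c * V)" using \<open>z \<tau> \<le> 0\<close> by linarith
  have right: "- 2 - \<epsilon> * c * V < z \<tau>"
  proof -
    have "\<bar>sin (\<tau> - 2 * pi)\<bar> \<le> \<bar>\<tau> - 2 * pi\<bar>" by (rule abs_sin_x_le_abs_x)
    also have "\<dots> \<le> \<sigma>" using \<tau>ab by auto
    finally have "V * \<bar>sin \<tau>\<bar> \<le> V * \<sigma>" using V_pos by (simp add: sin_diff)
    moreover have "\<bar>V * sin \<tau>\<bar> = V * \<bar>sin \<tau>\<bar>" using V_pos by (simp add: abs_mult)
    ultimately have "\<bar>V * sin \<tau>\<bar> \<le> 1 / 2" using \<sigma>(3) by linarith
    then have "\<bar>z \<tau>\<bar> < 1" using drift(1)[of \<tau>] \<tau>ab ab(3) small(4) by auto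
    moreover have "\<bar>\<epsilon> * c * V\<bar> < 1"
      using small(5) eps V_pos by (simp add: abs_mult mult.assoc)
    ultimately show ?thesis by linarith
  qed
  show thesis
  proof (rule that[of \<tau>])
    show "\<tau> > 0" using \<tau>(1) ab by auto
    show "y \<tau> = V" using \<tau>(2) by simp
    show "y t \<le> V" if t: "t \<in> {0..\<tau>}" for t
    proof -
      consider "t \<in> {0..1}" | "t \<in> {\<sigma>..?a}" | "t \<in> {?a..<\<tau>}" | "t = \<tau>"
        using t \<sigma>(2) by fastforce
      then show ?thesis
        by cases (use stays_below_initially[OF small(1)] below \<tau>(2,3) in \<open>force intro: less_imp_le\<close>)+
    qed
    show "z \<tau> \<in> {- 2 - \<epsilon> * c * V<..<- (\<epsilon> * c * V)}" using left right by simp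
  qed
qed

end

section \<open>The finite-time stable limit cycle\<close>

lemma (in friction_oscillator) lower_lipschitz:
  "norm (lower u - lower v) \<le> (2 + M) * norm (u - v)"
proof -
  define d1 d2 where "d1 = fst u - fst v" and "d2 = snd u - snd v"
  define k where "k = F (snd u - V) \<epsilon> - F (snd v - V) \<epsilon>"
  have d: "\<bar>d1\<bar> \<le> norm (u - v)" "\<bar>d2\<bar> \<le> norm (u - v)"
    using norm_fst_le[of d1 d2] norm_snd_le[of d2 d1] by (simp_all add: d1_def d2_def minus_prod_def)
  have k: "\<bar>k\<bar> \<le> L * \<bar>d2\<bar>"
    using F_lipschitz[of "snd u - V" "snd v - V"] by (simp add: k_def d2_def)
  have "lower u - lower v = (d2, - d1 - \<epsilon> * c * d2 + k)"
    by (simp add: lower_def d1_def d2_def k_def algebra_simps)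
  then have "norm (lower u - lower v) \<le> \<bar>d2\<bar> + \<bar>- d1 - \<epsilon> * c * d2 + k\<bar>"
    using norm_Pair_le[of d2 "- d1 - \<epsilon> * c * d2 + k"] by simp
  also have "\<dots> \<le> \<bar>d2\<bar> + (\<bar>d1\<bar> + \<bar>\<epsilon> * c\<bar> * \<bar>d2\<bar> + L * \<bar>d2\<bar>)"
  proof -
    have "\<bar>\<epsilon> * c * d2\<bar> = \<bar>\<epsilon> * c\<bar> * \<bar>d2\<bar>" by (rule abs_mult)
    then show ?thesis using k by linarith
  qed
  also have "\<dots> = \<bar>d1\<bar> + (1 + M) * \<bar>d2\<bar>" by (simp add: M_def algebra_simps)
  also have "\<dots> \<le> norm (u - v) + (1 + M) * norm (u - v)"
    using d M_nonneg by (intro add_mono mult_left_mono) auto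
  finally show ?thesis by (simp add: algebra_simps)
qed

lemma eventually_mult_less:
  fixes a b :: real
  assumes "b > 0"
  shows "\<forall>\<^sub>F \<epsilon> in at_right 0. a * \<epsilon> < b"
proof -
  have "((\<lambda>\<epsilon>. a * \<epsilon>) \<longlongrightarrow> a * 0) (at_right 0)" by (intro tendsto_intros)
  then show ?thesis using assms by (intro order_tendstoD(2)) auto
qed

theorem proposition2:
  fixes V c L :: real
    and F DF :: "real \<Rightarrow> real \<Rightarrow> real"
  assumes V_pos: "V > 0"
    and F_Lipschitz: "L-lipschitz_on (UNIV \<times> {0..}) (\<lambda>(u, \<epsilon>). F u \<epsilon>)"
    and F_deriv: "\<And>u \<epsilon>. \<epsilon> \<ge> 0 \<Longrightarrow> (F u has_real_derivative DF u \<epsilon>) (at \<epsilon> within {0..})"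
    and F_zero_left: "\<And>\<epsilon>. \<epsilon> \<ge> 0 \<Longrightarrow> F 0 \<epsilon> = 0"
    and F_zero_right: "\<And>u. F u 0 = 0"
    and criterion: "c * V * pi < integral {0..2 * pi} (\<lambda>\<tau>. DF (V * cos \<tau> - V) 0 * cos \<tau>)"
  shows "\<exists>\<epsilon>0>0. \<forall>\<epsilon>. 0 < \<epsilon> \<and> \<epsilon> < \<epsilon>0 \<longrightarrow>
    (\<exists>x. filippov_solution (friction_field V c F \<epsilon>) V x \<and>
         x 0 = (1 - \<epsilon> * c * V, V) \<and>
         (\<forall>y. filippov_solution (friction_field V c F \<epsilon>) V y \<and> y 0 = (1 - \<epsilon> * c * V, V)
              \<longrightarrow> (\<forall>t\<ge>0. y t = x t)) \<and>
         (\<exists>t>0. \<exists>\<xi>1. \<xi>1 \<in> {- 1 - \<epsilon> * c * V <..< 1 - \<epsilon> * c * V} \<and> x t = (\<xi>1, V)) \<and>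
         limit_cycle (friction_field V c F \<epsilon>) V x \<and>
         finite_time_stable (friction_field V c F \<epsilon>) V (trajectory x))"
proof -
  have L: "L \<ge> 0" using F_Lipschitz by (rule lipschitz_on_nonneg)
  have lip: "\<bar>F u \<epsilon> - F v \<epsilon>\<bar> \<le> L * \<bar>u - v\<bar>" if "\<epsilon> \<ge> 0" for u v \<epsilon>
    using lipschitz_onD[OF F_Lipschitz, of "(u, \<epsilon>)" "(v, \<epsilon>)"] that
    by (simp add: dist_Pair_Pair dist_real_def)
  have bound: "\<bar>F u \<epsilon>\<bar> \<le> L * \<epsilon>" if "\<epsilon> \<ge> 0" for u \<epsilon>
    using lipschitz_onD[OF F_Lipschitz, of "(u, \<epsilon>)" "(u, 0)"] that F_zero_right
    by (simp add: dist_Pair_Pair dist_real_def)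
  have cont: "continuous_on UNIV (\<lambda>u. F u \<epsilon>)" if "\<epsilon> \<ge> 0" for \<epsilon>
  proof -
    have "L-lipschitz_on UNIV (\<lambda>u. F u \<epsilon>)"
      using lip[OF that] L by (intro lipschitz_onI) (auto simp: dist_real_def)
    then show ?thesis by (rule lipschitz_on_continuous_on)
  qed
  obtain \<epsilon>g m where \<epsilon>g: "\<epsilon>g > 0" and m: "m > 0" and
    gain: "\<And>\<epsilon> z y. perturbed_oscillator V c \<epsilon> L F z y \<Longrightarrow> \<epsilon> < \<epsilon>g \<Longrightarrow>
      (z (2 * pi))\<^sup>2 + (y (2 * pi))\<^sup>2 \<ge> V\<^sup>2 + \<epsilon> * m"
    using energy_gain[where F = F and DF = DF, OF V_pos L bound cont F_deriv[OF order.refl] F_zero_right criterion] by blast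
  define K where "K = drift_bound V c L"
  \<comment> \<open>The rate, per unit of \<open>\<epsilon>\<close>, at which the energy can change; during \<open>\<sigma>\<close> at most half of the gain is lost.\<close>
  define G where "G = 2 * amplitude_bound V c L * (\<bar>c\<bar> * amplitude_bound V c L + L)"
  have G: "G \<ge> 0" using L by (simp add: G_def amplitude_bound_def)
  define \<sigma> where "\<sigma> = min (1 / 2) (min (1 / (2 * V)) (m / (2 * (G + 1))))"
  have \<sigma>: "0 < \<sigma>" "\<sigma> \<le> 1 / 2" "V * \<sigma> \<le> 1 / 2" "G * \<sigma> \<le> m / 2"
  proof -
    show "0 < \<sigma>" using V_pos m G by (simp add: \<sigma>_def)
    show "\<sigma> \<le> 1 / 2" unfolding \<sigma>_def by (rule min.cobounded1)
    have "\<sigma> \<le> 1 / (2 * V)" unfolding \<sigma>_def by (intro min.coboundedI2 min.cobounded1)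
    then show "V * \<sigma> \<le> 1 / 2" using V_pos by (simp add: field_simps)
    have "\<sigma> \<le> m / (2 * (G + 1))" unfolding \<sigma>_def by (intro min.coboundedI2 min.cobounded2)
    then have "(G + 1) * \<sigma> \<le> m / 2" using G by (simp add: field_simps)
    then show "G * \<sigma> \<le> m / 2" using \<open>0 < \<sigma>\<close> by (simp add: algebra_simps)
  qed
  have pos: "V * cos 1 > 0" "V * sin \<sigma> > 0" "V * (1 - cos \<sigma>) > 0"
  proof -
    show "V * cos 1 > 0" using V_pos pi_gt3 cos_gt_zero_pi[of 1] by simp
    show "V * sin \<sigma> > 0" using V_pos \<sigma> pi_gt3 sin_gt_zero[of \<sigma>] by simp
    show "V * (1 - cos \<sigma>) > 0"
      using V_pos \<sigma> pi_gt3 cos_monotone_0_pi[of 0 \<sigma>] by simp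
  qed
  \<comment> \<open>The factor \<open>1\<close> brings all conditions on \<open>\<epsilon>\<close> to the same form.\<close>
  have "\<forall>\<^sub>F \<epsilon> in at_right 0. 1 * \<epsilon> < 1 \<and> 1 * \<epsilon> < \<epsilon>g \<and> K * \<epsilon> < V * cos 1 \<and> K * \<epsilon> < V * sin \<sigma> \<and>
      K * \<epsilon> < V * (1 - cos \<sigma>) \<and> K * \<epsilon> < 1 / 2 \<and> (\<bar>c\<bar> * V) * \<epsilon> < 1 \<and> (c\<^sup>2 * V\<^sup>2) * \<epsilon> < m / 2"
    by (intro eventually_conj eventually_mult_less pos) (use \<epsilon>g m in auto)
  then obtain \<epsilon>0 where \<epsilon>0: "\<epsilon>0 > 0" and small: "\<And>\<epsilon>. 0 < \<epsilon> \<Longrightarrow> \<epsilon> < \<epsilon>0 \<Longrightarrow>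
      \<epsilon> < 1 \<and> \<epsilon> < \<epsilon>g \<and> K * \<epsilon> < V * cos 1 \<and> K * \<epsilon> < V * sin \<sigma> \<and>
      K * \<epsilon> < V * (1 - cos \<sigma>) \<and> K * \<epsilon> < 1 / 2 \<and> (\<bar>c\<bar> * V) * \<epsilon> < 1 \<and> (c\<^sup>2 * V\<^sup>2) * \<epsilon> < m / 2"
    unfolding eventually_at_right_field mult_1 by auto
  show ?thesis
  proof (intro exI[of _ \<epsilon>0] conjI \<epsilon>0 allI impI; elim conjE)
    fix \<epsilon> :: real assume \<epsilon>: "0 < \<epsilon>" "\<epsilon> < \<epsilon>0"
    interpret friction_oscillator V c \<epsilon> L F
      using V_pos F_zero_left lip \<epsilon> by unfold_locales auto
    obtain \<phi> where \<phi>0: "\<phi> 0 = (1 - \<epsilon> * c * V, V)"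
      and \<phi>: "\<And>t. t \<ge> 0 \<Longrightarrow> (\<phi> has_vector_derivative lower (\<phi> t)) (at t within {0..})"
      using lipschitz_ode_solution_exists[of lower "2 + M", OF lower_lipschitz] by blast
    define z where "z t = fst (\<phi> t) - 1" for t
    define y where "y t = snd (\<phi> t)" for t
    interpret perturbed_oscillator V c \<epsilon> L F z y
    proof unfold_locales
      show "\<bar>F u \<epsilon>\<bar> \<le> L * \<epsilon>" for u using bound \<epsilon> by simp
      fix t :: real assume "t \<ge> 0"
      note d = bounded_linear.has_vector_derivative[OF bounded_linear_fst \<phi>[OF this]]
        bounded_linear.has_vector_derivative[OF bounded_linear_snd \<phi>[OF this]]
      show "(z has_real_derivative y t) (at t within {0..})"
        using d(1) unfolding z_def y_def lower_def has_real_derivative_iff_has_vector_derivative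
        by (auto intro!: derivative_eq_intros)
      show "(y has_real_derivative - z t - \<epsilon> * c * y t + F (y t - V) \<epsilon>) (at t within {0..})"
        using d(2) by (simp add: z_def y_def[abs_def] lower_def has_real_derivative_iff_has_vector_derivative algebra_simps)
    qed (use \<epsilon> small[OF \<epsilon>] \<phi>0 in \<open>auto simp: z_def y_def\<close>)
    obtain \<tau> where \<tau>: "\<tau> > 0" "y \<tau> = V" "\<And>t. t \<in> {0..\<tau>} \<Longrightarrow> y t \<le> V"
        "z \<tau> \<in> {- 2 - \<epsilon> * c * V<..<- (\<epsilon> * c * V)}"
    proof (rule return_to_line[OF _ m \<sigma>(1,2,3)])
      show "V\<^sup>2 + \<epsilon> * m \<le> E (2 * pi)"
        unfolding E_def using small[OF \<epsilon>] by (intro gain perturbed_oscillator_axioms) auto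
    qed (use small[OF \<epsilon>] \<sigma>(4) in \<open>auto simp: K_def G_def mult.commute\<close>)
    interpret stick_slip_orbit V c \<epsilon> L F \<phi> \<tau> "z \<tau> + 1"
    proof unfold_locales
      show "(\<phi> has_vector_derivative lower (\<phi> t)) (at t within {0..\<tau>})" if "t \<in> {0..\<tau>}" for t
        by (rule has_vector_derivative_within_subset[OF \<phi>]) (use that in auto)
      show "snd (\<phi> t) \<le> V" if "t \<in> {0..\<tau>}" for t using \<tau>(3)[OF that] by (simp add: y_def)
      show "\<phi> \<tau> = (z \<tau> + 1, V)" using \<tau>(2) by (simp add: z_def y_def prod_eq_iff)
    qed (use \<tau>(1,4) \<phi>0 in auto)
    show "\<exists>x. solution x \<and> x 0 = (1 - \<epsilon> * c * V, V) \<and>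
         (\<forall>y. solution y \<and> y 0 = (1 - \<epsilon> * c * V, V) \<longrightarrow> (\<forall>t\<ge>0. y t = x t)) \<and>
         (\<exists>t>0. \<exists>\<xi>1. \<xi>1 \<in> {- 1 - \<epsilon> * c * V <..< 1 - \<epsilon> * c * V} \<and> x t = (\<xi>1, V)) \<and>
         limit_cycle (friction_field V c F \<epsilon>) V x \<and>
         finite_time_stable (friction_field V c F \<epsilon>) V (trajectory x)"
    proof (intro exI[of _ orbit] conjI)
      show "\<forall>y. solution y \<and> y 0 = (1 - \<epsilon> * c * V, V) \<longrightarrow> (\<forall>t\<ge>0. y t = orbit t)"
        using solution_unique[OF _ solution_orbit] orbit_0 by auto
      show "\<exists>t>0. \<exists>\<xi>1. \<xi>1 \<in> {- 1 - \<epsilon> * c * V <..< 1 - \<epsilon> * c * V} \<and> orbit t = (\<xi>1, V)"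
        using tau_pos orbit_tau xi by blast
    qed (rule solution_orbit orbit_0 limit_cycle_orbit finite_time_stable_orbit)+
  qed
qed

end
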